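(* Let $\Phi\in C^1(\mathbb{R},[0,+\infty))$ be an N-function and let $(u_n)\subset W^{1,\Phi}(\mathbb{R}^N)$ be a sequence such that $\int_{\mathbb{R}^N}\Phi(|\nabla u_n|)\,dx\le M$ for all $n\in\mathbb{N}$, for some constant $M$. If there are $\epsilon,\delta>0$ such that $$\mathrm{mes}(\{x\in\mathbb{R}^N:|u_n(x)|>\epsilon\})\ge\delta,\quad\forall n\in\mathbb{N},$$ then there is $(z_n)\subset\mathbb{Z}^N$ such that the sequence $v_n(x)=u_n(x+z_n)$ has a subsequence that converges in $L^{\Phi}_{loc}(\mathbb{R}^N)$ to a nontrivial (i.e. not a.e. zero) limit.
   Context: A continuous function $\Phi:\mathbb{R}\to[0,+\infty)$ is an N-function if it is convex, even, $\Phi(t)=0\Leftrightarrow t=0$, $\lim_{t\to0}\Phi(t)/t=0$ and $\lim_{t\to+\infty}\Phi(t)/t=+\infty$. No $\Delta_2$-condition is assumed. For an open set $\Omega\subset\mathbb{R}^N$, $L^{\Phi}(\Omega)=\{u\in L^1_{loc}(\Omega): \int_\Omega\Phi(|u|/\alpha)\,dx<+\infty \text{ for some }\alpha>0\}$ with the Luxemburg norm $\|u\|_\Phi=\inf\{\alpha>0:\int_\Omega\Phi(|u|/\alpha)\,dx\le1\}$, and $W^{1,\Phi}(\Omega)=\{u\in L^\Phi(\Omega): \partial u/\partial x_i\in L^\Phi(\Omega),\ i=1,\dots,N\}$ with norm $\|u\|=\|\nabla u\|_\Phi+\|u\|_\Phi$. Convergence in $L^\Phi_{loc}(\mathbb{R}^N)$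 means convergence in the norm of $L^\Phi(K)$ for every bounded set $K\subset\mathbb{R}^N$. $\mathrm{mes}$ denotes Lebesgue measure. *)

theory Defs
  imports "HOL-Analysis.Analysis"
begin

definition N_function :: "(real \<Rightarrow> real) \<Rightarrow> bool" where
  "N_function \<Phi> \<longleftrightarrow>
     continuous_on UNIV \<Phi> \<and> (\<forall>t. 0 \<le> \<Phi> t) \<and> convex_on UNIV \<Phi> \<and>
     (\<forall>t. \<Phi> (- t) = \<Phi> t) \<and> (\<forall>t. \<Phi> t = 0 \<longleftrightarrow> t = 0) \<and>
     ((\<lambda>t. \<Phi> t / t) \<longlongrightarrow> 0) (at 0) \<and>
     filterlim (\<lambda>t. \<Phi> t / t) at_top at_top"

text \<open>Function spaces are sets of representatives, not of a.e.-equivalence classes, and the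
  values of a representative outside \<^term>\<open>\<Omega>\<close> are irrelevant.\<close>

definition L1_loc :: "(real^'n) set \<Rightarrow> (real^'n \<Rightarrow> real) set" where
  "L1_loc \<Omega> = {u. \<forall>K. compact K \<and> K \<subseteq> \<Omega> \<longrightarrow> set_integrable lebesgue K u}"

text \<open>The modular is an extended nonnegative integral, so that divergence means the value
  \<^term>\<open>\<infinity>\<close> (the Bochner integral would give 0).\<close>

definition modular :: "(real \<Rightarrow> real) \<Rightarrow> (real^'n) set \<Rightarrow> (real^'n \<Rightarrow> real) \<Rightarrow> ennreal" where
  "modular \<Phi> \<Omega> u = (\<integral>\<^sup>+x\<in>\<Omega>. ennreal (\<Phi> \<bar>u x\<bar>) \<partial>lebesgue)"

definition orlicz_space :: "(real \<Rightarrow> real) \<Rightarrow> (real^'n) set \<Rightarrow> (real^'n \<Rightarrow> real) set" where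
  "orlicz_space \<Phi> \<Omega> = {u \<in> L1_loc \<Omega>. \<exists>\<alpha>>0. modular \<Phi> \<Omega> (\<lambda>x. u x / \<alpha>) < \<infinity>}"

text \<open>Meaningful only for \<^term>\<open>u \<in> orlicz_space \<Phi> \<Omega>\<close>; otherwise the set may be empty.\<close>

definition luxemburg_norm :: "(real \<Rightarrow> real) \<Rightarrow> (real^'n) set \<Rightarrow> (real^'n \<Rightarrow> real) \<Rightarrow> real" where
  "luxemburg_norm \<Phi> \<Omega> u = Inf {\<alpha>. 0 < \<alpha> \<and> modular \<Phi> \<Omega> (\<lambda>x. u x / \<alpha>) \<le> 1}"

primrec Ck :: "nat \<Rightarrow> (real^'n \<Rightarrow> real) \<Rightarrow> bool" where
  "Ck 0 f \<longleftrightarrow> continuous_on UNIV f"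
| "Ck (Suc k) f \<longleftrightarrow>
     f differentiable_on UNIV \<and> (\<forall>v. Ck k (\<lambda>x. frechet_derivative f (at x) v))"

text \<open>\<open>C\<^sub>c\<^sup>\<infinity>(\<Omega>)\<close>, its elements being extended by 0 to the whole space.\<close>

definition test_functions :: "(real^'n) set \<Rightarrow> (real^'n \<Rightarrow> real) set" where
  "test_functions \<Omega> =
     {\<phi>. (\<forall>k. Ck k \<phi>) \<and> compact (closure {x. \<phi> x \<noteq> 0}) \<and> closure {x. \<phi> x \<noteq> 0} \<subseteq> \<Omega>}"

definition is_weak_pderiv ::
  "(real^'n) set \<Rightarrow> 'n \<Rightarrow> (real^'n \<Rightarrow> real) \<Rightarrow> (real^'n \<Rightarrow> real) \<Rightarrow> bool" where
  "is_weak_pderiv \<Omega> i u g \<longleftrightarrow>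
     u \<in> L1_loc \<Omega> \<and> g \<in> L1_loc \<Omega> \<and>
     (\<forall>\<phi> \<in> test_functions \<Omega>.
        (LINT x:\<Omega>|lebesgue. u x * frechet_derivative \<phi> (at x) (axis i 1)) =
        - (LINT x:\<Omega>|lebesgue. g x * \<phi> x))"

text \<open>For open \<^term>\<open>\<Omega>\<close>, weak derivatives are unique up to null sets in \<^term>\<open>\<Omega>\<close>, so the
  choice below does not affect any integral over \<^term>\<open>\<Omega>\<close>.\<close>

definition weak_pderiv ::
  "(real^'n) set \<Rightarrow> 'n \<Rightarrow> (real^'n \<Rightarrow> real) \<Rightarrow> real^'n \<Rightarrow> real" where
  "weak_pderiv \<Omega> i u = (SOME g. is_weak_pderiv \<Omega> i u g)"

definition weak_grad :: "(real^'n) set \<Rightarrow> (real^'n \<Rightarrow> real) \<Rightarrow> real^'n \<Rightarrow> real^'n" where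
  "weak_grad \<Omega> u x = (\<chi> i. weak_pderiv \<Omega> i u x)"

definition orlicz_sobolev_space :: "(real \<Rightarrow> real) \<Rightarrow> (real^'n) set \<Rightarrow> (real^'n \<Rightarrow> real) set" where
  "orlicz_sobolev_space \<Phi> \<Omega> =
     {u \<in> orlicz_space \<Phi> \<Omega>. \<forall>i. \<exists>g \<in> orlicz_space \<Phi> \<Omega>. is_weak_pderiv \<Omega> i u g}"

text \<open>Membership in the space is part of convergence, as the norm is not meaningful
  outside of it.\<close>

definition converges_orlicz_loc ::
  "(real \<Rightarrow> real) \<Rightarrow> (nat \<Rightarrow> real^'n \<Rightarrow> real) \<Rightarrow> (real^'n \<Rightarrow> real) \<Rightarrow> bool" where
  "converges_orlicz_loc \<Phi> f v \<longleftrightarrow>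
     (\<forall>K. bounded K \<and> K \<in> sets lebesgue \<longrightarrow>
        (\<forall>n. f n \<in> orlicz_space \<Phi> K) \<and> v \<in> orlicz_space \<Phi> K \<and>
        (\<lambda>n. luxemburg_norm \<Phi> K (\<lambda>x. f n x - v x)) \<longlonglongrightarrow> 0)"

end

theory Submission
  imports Defs "HOL-Probability.Probability_Measure" "HOL-Complex_Analysis.Great_Picard"
begin

text \<open>The whole argument rests on one inequality. For a weakly differentiable \<open>u\<close> the increment
  \<open>u(x + s) - u(x)\<close> is the mean of \<open>\<nabla>u \<cdot> s\<close> over the segment from \<open>x\<close> to \<open>x + s\<close> for almost every
  \<open>x\<close> (\<open>increment_eq_segment_average\<close>). Jensen's inequality and Tonelli's theorem turn this into
  \<open>\<integral> \<Phi>((u(x + s) - u(x)) / c) dx \<le> \<integral> \<Phi>(\<bar>\<nabla>u\<bar>) \<le> m\<close> whenever \<open>\<bar>s\<bar> \<le> c\<close>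
  (\<open>increments_bounded_of_weak_gradient\<close>).

  Let \<open>A\<^sub>h u\<close> denote the mean of \<open>u\<close> over balls of radius \<open>h\<close>. Jensen's inequality gives two
  consequences: \<open>\<integral> \<Phi>((A\<^sub>h u - u) / h) \<le> m\<close> (\<open>modular_ball_average_diff\<close>), and \<open>A\<^sub>h u\<close> is
  Lipschitz with a constant that depends only on \<open>h\<close> and \<open>m\<close> (\<open>ball_average_Lipschitz\<close>).

  Nontriviality. For a small fixed \<open>h\<close> the first consequence forces \<open>\<bar>A\<^sub>h u\<^sub>n\<bar> > \<epsilon>/2\<close> at some
  point of the set where \<open>\<bar>u\<^sub>n\<bar> > \<epsilon>\<close>. Since \<open>u\<^sub>n\<close> has a finite modular, \<open>\<bar>A\<^sub>h u\<^sub>n\<bar>\<close> is also below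
  \<open>\<epsilon>/2\<close> somewhere, so it equals \<open>\<epsilon>/2\<close> at some point (\<open>ball_average_attains_level\<close>), which an
  integer translation moves into the unit cube. This anchors the translated functions \<open>v\<^sub>n\<close> from
  above and from below.

  Compactness. By the Lipschitz bounds the anchor bounds all averages \<open>A\<^sub>h v\<^sub>n\<close> locally uniformly,
  and a diagonal sequence makes them converge for all \<open>h = 4\<^sup>-\<^sup>k\<close>. As \<open>v\<^sub>n - A\<^sub>h v\<^sub>n\<close> has
  Luxemburg norm \<open>O(h)\<close> on the whole space, uniformly in \<open>n\<close>, the sequence converges in norm on
  bounded sets (\<open>modular_compactness\<close>). The factor \<open>1/h\<close> inside \<open>\<Phi>\<close> is what makes the
  \<open>\<Delta>\<^sub>2\<close> condition unnecessary. If the limit were zero, the averages at the anchor would tend to 0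
  (\<open>modular_limit_nontrivial\<close>).\<close>

section \<open>Smooth cut-offs of boxes\<close>

text \<open>The functions \<open>p(1/t) exp(-1/t)\<close>, extended by 0 to \<open>t \<le> 0\<close>. For varying polynomials \<open>p\<close>
  this class is closed under differentiation, so all its members are smooth.\<close>

definition flat_exp :: "real poly \<Rightarrow> real \<Rightarrow> real" where
  "flat_exp p t = (if t \<le> 0 then 0 else poly p (1 / t) * exp (- (1 / t)))"

lemma poly_times_exp_minus_tendsto_0:
  "((\<lambda>s::real. poly p s * exp (- s)) \<longlongrightarrow> 0) at_top"
proof -
  have "((\<lambda>s::real. \<Sum>i\<le>degree p. coeff p i * (s ^ i / exp s)) \<longlongrightarrow> (\<Sum>i\<le>degree p. coeff p i * 0)) at_top"
    by (intro tendsto_intros tendsto_power_div_exp_0)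
  then show ?thesis
    by (simp add: poly_altdef sum_distrib_right exp_minus divide_inverse mult.assoc)
qed

lemma flat_exp_tendsto_0: "(flat_exp p \<longlongrightarrow> 0) (at_right 0)"
proof -
  have "((\<lambda>t. poly p (inverse t) * exp (- (inverse t))) \<longlongrightarrow> 0) (at_right 0)"
    by (rule filterlim_compose[OF poly_times_exp_minus_tendsto_0 filterlim_inverse_at_top_right])
  then show ?thesis
    by (rule Lim_transform_eventually)
       (auto simp: flat_exp_def eventually_at_filter divide_inverse)
qed

lemma flat_exp_has_real_derivative:
  "(flat_exp p has_real_derivative flat_exp ([:0, 0, 1:] * (p - pderiv p)) t) (at t)"
proof -
  consider "t < 0" | "t = 0" | "t > 0" by linarith
  then show ?thesis
  proof cases
    case 1
    have "((\<lambda>_. 0) has_real_derivative 0) (at t)" by simp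
    then have "(flat_exp p has_real_derivative 0) (at t)"
      by (rule has_field_derivative_transform_within_open[where S = "{..<0}"])
         (use 1 in \<open>auto simp: flat_exp_def\<close>)
    then show ?thesis using 1 by (simp add: flat_exp_def)
  next
    case 2
    have "((\<lambda>h. flat_exp p h / h) \<longlongrightarrow> 0) (at_right 0)"
      by (rule Lim_transform_eventually[OF flat_exp_tendsto_0[of "pCons 0 p"]])
         (auto simp: flat_exp_def eventually_at_filter)
    moreover have "((\<lambda>h. flat_exp p h / h) \<longlongrightarrow> 0) (at_left 0)"
      by (rule tendsto_eventually) (auto simp: flat_exp_def eventually_at_filter)
    ultimately have "((\<lambda>h. flat_exp p h / h) \<longlongrightarrow> 0) (at 0)"
      by (simp add: filterlim_split_at)
    then show ?thesis
      using 2 by (simp add: DERIV_def) (simp add: flat_exp_def)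
  next
    case 3
    have "((\<lambda>t. poly p (1 / t) * exp (- (1 / t))) has_real_derivative
            flat_exp ([:0, 0, 1:] * (p - pderiv p)) t) (at t)"
      using 3
      by (auto intro!: derivative_eq_intros
          simp: flat_exp_def field_simps power2_eq_square)
    then show ?thesis
      by (rule has_field_derivative_transform_within_open[where S = "{0<..}"])
         (use 3 in \<open>auto simp: flat_exp_def\<close>)
  qed
qed

lemma Ck_const: "Ck k (\<lambda>x. c)"
  by (induction k arbitrary: c) (auto simp: frechet_derivative_const)

lemma Ck_SucD: "Ck (Suc k) f \<Longrightarrow> Ck k f"
proof (induction k arbitrary: f)
  case 0
  then show ?case by (auto intro: differentiable_imp_continuous_on)
next
  case (Suc k)
  then show ?case
    by (metis Ck.simps(2))
qed

lemma Ck_Suc_has_derivative: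
  assumes "Ck (Suc k) f"
  shows "(f has_derivative frechet_derivative f (at x)) (at x)"
  using assms by (auto simp: differentiable_on_def frechet_derivative_works)

lemma Ck_SucI:
  assumes "\<And>x. (f has_derivative f' x) (at x)" and "\<And>v. Ck k (\<lambda>x. f' x v)"
  shows "Ck (Suc k) f"
proof -
  have "frechet_derivative f (at x) = f' x" for x
    by (rule frechet_derivative_at[OF assms(1), symmetric])
  moreover have "f differentiable_on UNIV"
    using assms(1) by (auto simp: differentiable_on_def differentiable_def)
  ultimately show ?thesis
    using assms(2) by simp
qed

lemma Ck_add: "Ck k f \<Longrightarrow> Ck k g \<Longrightarrow> Ck k (\<lambda>x. f x + g x)"
proof (induction k arbitrary: f g)
  case 0
  then show ?case by (auto intro: continuous_intros)
next
  case (Suc k)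
  show ?case
    using Suc by (intro Ck_SucI[OF has_derivative_add[OF Ck_Suc_has_derivative Ck_Suc_has_derivative]]) auto
qed

lemma Ck_mult: "Ck k f \<Longrightarrow> Ck k g \<Longrightarrow> Ck k (\<lambda>x. f x * g x)"
proof (induction k arbitrary: f g)
  case 0
  then show ?case by (auto intro: continuous_intros)
next
  case (Suc k)
  show ?case
  proof (intro Ck_SucI[OF has_derivative_mult[OF Ck_Suc_has_derivative Ck_Suc_has_derivative]] Ck_add Suc.IH)
    show "Ck (Suc k) f" "Ck (Suc k) g" by fact+
    show "Ck k f" "Ck k g" using Suc.prems by (auto dest: Ck_SucD simp del: Ck.simps)
    show "Ck k (\<lambda>x. frechet_derivative f (at x) v)" "Ck k (\<lambda>x. frechet_derivative g (at x) v)" for v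
      using Suc.prems by auto
  qed
qed

lemma Ck_prod: "finite I \<Longrightarrow> (\<And>i. i \<in> I \<Longrightarrow> Ck k (f i)) \<Longrightarrow> Ck k (\<lambda>x. \<Prod>i\<in>I. f i x)"
  by (induction I rule: finite_induct) (auto intro: Ck_const Ck_mult)

lemma Ck_flat_exp_coord: "Ck k (\<lambda>x::real^'n. flat_exp p (c * x $ i + d))"
proof (induction k arbitrary: p)
  case 0
  have "continuous_on UNIV (flat_exp p)"
    by (rule DERIV_continuous_on, rule flat_exp_has_real_derivative)
  then have "continuous_on UNIV (flat_exp p \<circ> (\<lambda>x::real^'n. c * x $ i + d))"
    by (intro continuous_on_compose continuous_intros) (auto elim: continuous_on_subset)
  then show ?case by (simp add: o_def)
next
  case (Suc k)
  let ?q = "[:0, 0, 1:] * (p - pderiv p)"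
  have "((\<lambda>x::real^'n. c * x $ i + d) has_derivative (\<lambda>v. c * v $ i)) (at x)" for x
    by (auto intro!: derivative_eq_intros bounded_linear.has_derivative[OF bounded_linear_vec_nth])
  from has_derivative_compose[OF this flat_exp_has_real_derivative[unfolded has_field_derivative_def]]
  have "((\<lambda>x::real^'n. flat_exp p (c * x $ i + d)) has_derivative
          (\<lambda>v. flat_exp ?q (c * x $ i + d) * (c * v $ i))) (at x)" for x .
  then show ?case
    by (rule Ck_SucI) (intro Ck_mult Suc.IH Ck_const)
qed

text \<open>A test function supported in a box, which increases to the indicator of the open box as
  \<open>k\<close> grows, because \<open>exp(-1/(k t))\<close> tends to 1 for every \<open>t > 0\<close>. These are the only test
  functions that the argument uses; translations of them are again of this form.\<close>

definition box_cutoff :: "nat \<Rightarrow> real^'n \<Rightarrow> real^'n \<Rightarrow> real^'n \<Rightarrow> real" where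
  "box_cutoff k a b x =
     (\<Prod>i\<in>UNIV. flat_exp 1 (real k * (x $ i - a $ i)) * flat_exp 1 (real k * (b $ i - x $ i)))"

lemma Ck_box_cutoff:
  fixes a b :: "real^'n"
  shows "Ck m (box_cutoff k a b)"
proof -
  have "Ck m (\<lambda>x::real^'n. \<Prod>i\<in>UNIV. flat_exp 1 (real k * x $ i + (- real k * a $ i)) *
                flat_exp 1 (- real k * x $ i + real k * b $ i))"
    by (intro Ck_prod Ck_mult Ck_flat_exp_coord) auto
  then show ?thesis
    by (simp add: box_cutoff_def[abs_def] algebra_simps)
qed

lemma flat_exp_1_bounds: "0 \<le> flat_exp 1 t" "flat_exp 1 t \<le> 1"
  by (auto simp: flat_exp_def)

lemma box_cutoff_bounds: "0 \<le> box_cutoff k a b x" "box_cutoff k a b x \<le> 1"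
  by (auto simp: box_cutoff_def flat_exp_1_bounds intro!: prod_nonneg prod_le_1 mult_le_one)

lemma box_cutoff_eq_0:
  assumes "x \<notin> box a b" shows "box_cutoff k a b x = 0"
proof -
  from assms obtain i where "x $ i \<le> a $ i \<or> b $ i \<le> x $ i"
    by (auto simp: mem_box_cart not_less)
  then have "flat_exp 1 (real k * (x $ i - a $ i)) * flat_exp 1 (real k * (b $ i - x $ i)) = 0"
    by (auto simp: flat_exp_def mult_nonneg_nonpos zero_less_mult_iff not_less mult_le_0_iff)
  then show ?thesis
    unfolding box_cutoff_def by (intro prod_zero) auto
qed

lemma box_cutoff_translate: "box_cutoff k a b (x - s) = box_cutoff k (a + s) (b + s) x"
  by (simp add: box_cutoff_def algebra_simps)

lemma box_cutoff_tendsto: "(\<lambda>k. box_cutoff k a b x) \<longlonglongrightarrow> indicator (box a b) x"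
proof (cases "x \<in> box a b")
  case True
  have 1: "(\<lambda>k. flat_exp 1 (real k * t)) \<longlonglongrightarrow> 1" if "t > 0" for t
  proof -
    have "(\<lambda>k. exp (- (inverse t * inverse (real k)))) \<longlonglongrightarrow> exp (- (inverse t * 0))"
      by (intro tendsto_intros lim_inverse_n)
    then have "(\<lambda>k. exp (- (inverse t * inverse (real k)))) \<longlonglongrightarrow> 1" by simp
    then show ?thesis
      by (rule Lim_transform_eventually)
         (use that in \<open>auto simp: eventually_sequentially flat_exp_def field_simps mult_le_0_iff intro!: exI[of _ 1]\<close>)
  qed
  have "(\<lambda>k. box_cutoff k a b x) \<longlonglongrightarrow> (\<Prod>i::'a\<in>UNIV. 1 * 1)"
    unfolding box_cutoff_def
    by (intro tendsto_prod tendsto_mult 1) (use True in \<open>auto simp: mem_box_cart\<close>)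
  with True show ?thesis by simp
next
  case False
  then show ?thesis by (simp add: box_cutoff_eq_0)
qed

lemma box_cutoff_test_function: "box_cutoff k a b \<in> test_functions UNIV"
proof -
  have "closure {x. box_cutoff k a b x \<noteq> 0} \<subseteq> cbox a b"
    by (rule closure_minimal)
       (use box_cutoff_eq_0 box_subset_cbox in \<open>blast intro: closed_cbox\<close>)+
  then have "bounded (closure {x. box_cutoff k a b x \<noteq> 0})"
    using bounded_cbox bounded_subset by blast
  then have "compact (closure {x. box_cutoff k a b x \<noteq> 0})"
    by (simp add: compact_eq_bounded_closed)
  then show ?thesis
    by (simp add: test_functions_def Ck_box_cutoff)
qed

lemma box_cutoff_has_derivative:
  "(box_cutoff k a b has_derivative frechet_derivative (box_cutoff k a b) (at x)) (at x)"
  by (rule Ck_Suc_has_derivative[OF Ck_box_cutoff])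

lemma continuous_on_box_cutoff: "continuous_on S (box_cutoff k a b)"
  using Ck_box_cutoff[of 0 k a b] by (auto intro: continuous_on_subset)

lemma continuous_on_box_cutoff_derivative:
  "continuous_on S (\<lambda>x. frechet_derivative (box_cutoff k a b) (at x) v)"
proof -
  have "Ck (Suc 0) (box_cutoff k a b)" by (rule Ck_box_cutoff)
  then show ?thesis by (auto intro: continuous_on_subset)
qed

lemma box_cutoff_derivative_bound:
  obtains C where "0 \<le> C"
    "\<And>x. \<bar>frechet_derivative (box_cutoff k a b) (at x) v\<bar> \<le> C * indicator (cbox a b) x"
proof -
  let ?D = "\<lambda>x. frechet_derivative (box_cutoff k a b) (at x) v"
  have "bounded (?D ` cbox a b)"
    by (intro compact_imp_bounded compact_continuous_image continuous_on_box_cutoff_derivative compact_cbox)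
  then obtain C where C: "\<And>x. x \<in> cbox a b \<Longrightarrow> \<bar>?D x\<bar> \<le> C"
    by (auto simp: bounded_iff)
  have "?D x = 0" if "x \<notin> cbox a b" for x
  proof -
    have "((\<lambda>_. 0) has_derivative (\<lambda>_. 0)) (at x)" by simp
    then have "(box_cutoff k a b has_derivative (\<lambda>_. 0)) (at x)"
      by (rule has_derivative_transform_within_open[where s = "- cbox a b"])
         (use that box_subset_cbox[of a b] in \<open>auto simp: box_cutoff_eq_0 open_Compl closed_cbox subset_eq\<close>)
    from frechet_derivative_at[OF this, symmetric] show ?thesis by simp
  qed
  then show ?thesis
    using C by (intro that[of "max C 0"]) (force simp: indicator_def max_def)+
qed

section \<open>Translations and locally integrable functions\<close>

lemma nn_integral_lborel_shift:
  fixes f :: "'a::euclidean_space \<Rightarrow> ennreal"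
  assumes [measurable]: "f \<in> borel_measurable borel"
  shows "(\<integral>\<^sup>+x. f (x + c) \<partial>lborel) = (\<integral>\<^sup>+x. f x \<partial>lborel)"
proof -
  have "(\<integral>\<^sup>+x. f x \<partial>distr lborel borel ((+) c)) = (\<integral>\<^sup>+x. f (c + x) \<partial>lborel)"
    by (rule nn_integral_distr) auto
  then show ?thesis by (simp add: lborel_distr_plus add.commute)
qed

lemma integral_lborel_shift:
  fixes f :: "'a::euclidean_space \<Rightarrow> real"
  assumes [measurable]: "f \<in> borel_measurable borel"
  shows "(\<integral>x. f (x + c) \<partial>lborel) = (\<integral>x. f x \<partial>lborel)"
proof -
  have "(\<integral>x. f x \<partial>distr lborel borel ((+) c)) = (\<integral>x. f (c + x) \<partial>lborel)"
    by (rule integral_distr) auto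
  then show ?thesis by (simp add: lborel_distr_plus add.commute)
qed

lemma integrable_lborel_shift:
  fixes f :: "'a::euclidean_space \<Rightarrow> real"
  assumes [measurable]: "f \<in> borel_measurable borel"
  shows "integrable lborel (\<lambda>x. f (x + c)) \<longleftrightarrow> integrable lborel f"
proof -
  have "integrable (distr lborel borel ((+) c)) f \<longleftrightarrow> integrable lborel (\<lambda>x. f (c + x))"
    by (rule integrable_distr_eq) auto
  then show ?thesis by (simp add: lborel_distr_plus add.commute)
qed

lemma AE_lborel_shift:
  fixes c :: "'a::euclidean_space"
  assumes "AE x in lborel. P x"
  shows "AE x in lborel. P (x + c)"
proof -
  have "AE x in distr lborel borel ((+) c). P x"
    unfolding lborel_distr_plus by (rule assms)
  then have "AE x in lborel. P (c + x)"
    by (rule AE_distrD[rotated]) auto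
  then show ?thesis by (simp add: add.commute)
qed

text \<open>Borel functions that are integrable on bounded sets. Working with Borel representatives and
  \<^term>\<open>lborel\<close> makes compositions with translations measurable on products.\<close>

definition locally_integrable :: "('a::euclidean_space \<Rightarrow> real) \<Rightarrow> bool" where
  "locally_integrable f \<longleftrightarrow>
     f \<in> borel_measurable borel \<and> (\<forall>r. set_integrable lborel (cball 0 r) f)"

lemma locally_integrable_borel: "locally_integrable f \<Longrightarrow> f \<in> borel_measurable borel"
  by (simp add: locally_integrable_def)

lemma locally_integrable_bounded:
  assumes "locally_integrable f" "bounded B" "B \<in> sets borel"
  shows "set_integrable lborel B f"
proof -
  obtain r where "B \<subseteq> cball 0 r"
    using assms(2) by (auto simp: bounded_iff subset_eq)
  with assms show ?thesis
    by (auto simp: locally_integrable_def intro: set_integrable_subset)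
qed

lemma locally_integrable_add:
  "locally_integrable f \<Longrightarrow> locally_integrable g \<Longrightarrow> locally_integrable (\<lambda>x. f x + g x)"
  by (auto simp: locally_integrable_def intro: set_integral_add)

lemma locally_integrable_diff:
  "locally_integrable f \<Longrightarrow> locally_integrable g \<Longrightarrow> locally_integrable (\<lambda>x. f x - g x)"
  by (auto simp: locally_integrable_def intro: set_integral_diff)

lemma locally_integrable_cmult:
  "locally_integrable f \<Longrightarrow> locally_integrable (\<lambda>x. c * f x)"
  by (auto simp: locally_integrable_def)

lemma locally_integrable_sum:
  "finite I \<Longrightarrow> (\<And>i. i \<in> I \<Longrightarrow> locally_integrable (f i)) \<Longrightarrow> locally_integrable (\<lambda>x. \<Sum>i\<in>I. f i x)"
  by (induction I rule: finite_induct)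
     (auto intro: locally_integrable_add simp: locally_integrable_def[of "\<lambda>_. 0"] set_integrable_def)

lemma locally_integrable_shift:
  assumes "locally_integrable f" shows "locally_integrable (\<lambda>x. f (x + c))"
proof -
  have [measurable]: "f \<in> borel_measurable borel"
    by (rule locally_integrable_borel[OF assms])
  have "set_integrable lborel (cball 0 r) (\<lambda>x. f (x + c))" for r
  proof -
    have "set_integrable lborel (cball c r) f"
      by (rule locally_integrable_bounded[OF assms]) auto
    then have "integrable lborel (\<lambda>x. indicator (cball c r) (x + c) *\<^sub>R f (x + c))"
      unfolding set_integrable_def by (subst integrable_lborel_shift) auto
    moreover have "indicator (cball c r) (x + c) = (indicator (cball 0 r) x :: real)" for x
      by (simp add: indicator_def dist_norm)
    ultimately show ?thesis
      by (simp add: set_integrable_def)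
  qed
  then show ?thesis
    by (simp add: locally_integrable_def)
qed

lemma locally_integrable_mult_bounded:
  assumes "locally_integrable f" and [measurable]: "h \<in> borel_measurable borel"
    and h: "\<And>x. \<bar>h x\<bar> \<le> C * indicator B x" and B: "bounded B" "B \<in> sets borel"
  shows "integrable lborel (\<lambda>x. f x * h x)"
proof -
  have [measurable]: "f \<in> borel_measurable borel"
    by (rule locally_integrable_borel[OF assms(1)])
  have "integrable lborel (\<lambda>x. C * (indicator B x *\<^sub>R f x))"
    using locally_integrable_bounded[OF assms(1) B] by (auto simp: set_integrable_def)
  then show ?thesis
  proof (rule Bochner_Integration.integrable_bound)
    show "AE x in lborel. norm (f x * h x) \<le> norm (C * (indicator B x *\<^sub>R f x))"
    proof (intro AE_I2)
      fix x
      have "\<bar>f x\<bar> * \<bar>h x\<bar> \<le> \<bar>f x\<bar> * \<bar>C * indicator B x\<bar>"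
        using h[of x] by (intro mult_left_mono) auto
      then show "norm (f x * h x) \<le> norm (C * (indicator B x *\<^sub>R f x))"
        by (simp add: abs_mult mult_ac)
    qed
  qed simp
qed

text \<open>The positive and the negative part of \<open>f\<close> have the same integral over every open box, so the
  measures with these densities agree on a generator of the Borel sets.\<close>

lemma AE_eq_0_if_box_integrals_eq_0:
  assumes f: "locally_integrable f"
    and zero: "\<And>a b. (LINT x:box a b|lborel. f x) = 0"
  shows "AE x in lborel. f x = 0"
proof -
  have [measurable]: "f \<in> borel_measurable borel"
    by (rule locally_integrable_borel[OF f])
  have int: "integrable lborel (\<lambda>x. indicator (box a b) x * f x)" for a b
    using locally_integrable_bounded[OF f, of "box a b"] by (simp add: set_integrable_def)
  have int1: "integrable lborel (\<lambda>x. indicator (box a b) x * max 0 (f x))"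
    and int2: "integrable lborel (\<lambda>x. indicator (box a b) x * max 0 (- f x))" for a b
    by (rule Bochner_Integration.integrable_bound[OF int[of a b]];
        auto simp: indicator_def)+
  have eq: "emeasure (density lborel (\<lambda>x. ennreal (max 0 (f x)))) (box a b) =
        emeasure (density lborel (\<lambda>x. ennreal (max 0 (- f x)))) (box a b)"
    and fin: "emeasure (density lborel (\<lambda>x. ennreal (max 0 (f x)))) (box a b) \<noteq> \<infinity>" for a b
  proof -
    have e: "emeasure (density lborel (\<lambda>x. ennreal (g x))) (box a b) =
         ennreal (\<integral>x. indicator (box a b) x * g x \<partial>lborel)"
      if "\<And>x. 0 \<le> g x" "integrable lborel (\<lambda>x. indicator (box a b) x * g x)"
        "g \<in> borel_measurable borel" for g
      using that
      by (subst emeasure_density)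
         (auto simp: nn_integral_eq_integral[symmetric] ennreal_mult' ennreal_indicator mult.commute)
    have "0 = (LINT x:box a b|lborel. f x)" by (simp add: zero)
    also have "\<dots> = (\<integral>x. indicator (box a b) x * max 0 (f x) - indicator (box a b) x * max 0 (- f x) \<partial>lborel)"
      unfolding set_lebesgue_integral_def
      by (intro Bochner_Integration.integral_cong) (auto simp: indicator_def)
    also have "\<dots> = (\<integral>x. indicator (box a b) x * max 0 (f x) \<partial>lborel) -
                     (\<integral>x. indicator (box a b) x * max 0 (- f x) \<partial>lborel)"
      by (rule Bochner_Integration.integral_diff[OF int1 int2])
    finally have *: "(\<integral>x. indicator (box a b) x * max 0 (f x) \<partial>lborel) =
                     (\<integral>x. indicator (box a b) x * max 0 (- f x) \<partial>lborel)" by simp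
    have e1: "emeasure (density lborel (\<lambda>x. ennreal (max 0 (f x)))) (box a b) =
              ennreal (\<integral>x. indicator (box a b) x * max 0 (f x) \<partial>lborel)"
      by (rule e[OF _ int1]) auto
    have e2: "emeasure (density lborel (\<lambda>x. ennreal (max 0 (- f x)))) (box a b) =
              ennreal (\<integral>x. indicator (box a b) x * max 0 (- f x) \<partial>lborel)"
      by (rule e[OF _ int2]) auto
    show "emeasure (density lborel (\<lambda>x. ennreal (max 0 (f x)))) (box a b) =
        emeasure (density lborel (\<lambda>x. ennreal (max 0 (- f x)))) (box a b)"
      unfolding e1 e2 * ..
    show "emeasure (density lborel (\<lambda>x. ennreal (max 0 (f x)))) (box a b) \<noteq> \<infinity>"
      unfolding e1 by simp
  qed
  have "density lborel (\<lambda>x. ennreal (max 0 (f x))) = density lborel (\<lambda>x. ennreal (max 0 (- f x)))"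
  proof (rule measure_eqI_generator_eq[where \<Omega> = UNIV and E = "range (\<lambda>(a, b). box a b)"
        and A = "\<lambda>n. box (- (real n *\<^sub>R One)) (real n *\<^sub>R One)"])
    show "Int_stable (range (\<lambda>(a, b). box a b) :: 'a set set)"
      by (auto simp: Int_stable_def box_Int_box)
    show "(\<Union>i. box (- (real i *\<^sub>R One)) (real i *\<^sub>R One)) = (UNIV :: 'a set)"
      by (rule UN_box_eq_UNIV)
  qed (use eq fin in \<open>auto simp: borel_eq_box image_def\<close>)
  then have "AE x in lborel. ennreal (max 0 (f x)) = ennreal (max 0 (- f x))"
    by (intro sigma_finite_measure.density_unique[OF sigma_finite_lborel]) auto
  then show ?thesis
    by (rule AE_mp) (auto intro!: AE_I2 simp: max_def split: if_splits)
qed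

section \<open>Averages against a probability measure\<close>

text \<open>A Borel probability measure \<open>\<mu>\<close> of bounded support. Both averages used below, over a ball and
  along a segment, are of the form \<open>\<integral> f (x + y) d\<mu>(y)\<close> for such a \<open>\<mu>\<close>.\<close>

definition bounded_prob :: "'a::euclidean_space measure \<Rightarrow> bool" where
  "bounded_prob \<mu> \<longleftrightarrow> prob_space \<mu> \<and> sets \<mu> = sets borel \<and> (\<exists>R. AE y in \<mu>. norm y \<le> R)"

lemma integrable_lborel_pairI:
  fixes k :: "'a::euclidean_space \<times> 'b \<Rightarrow> real"
  assumes "prob_space \<mu>" and [measurable]: "k \<in> borel_measurable (lborel \<Otimes>\<^sub>M \<mu>)"
    and B: "AE y in \<mu>. (\<integral>\<^sup>+x. ennreal (norm (k (x, y))) \<partial>lborel) \<le> B" "B < \<infinity>"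
  shows "integrable (lborel \<Otimes>\<^sub>M \<mu>) k"
proof (rule integrableI_bounded)
  interpret prob_space \<mu> by fact
  interpret P: pair_sigma_finite lborel \<mu> ..
  have "(\<integral>\<^sup>+p. ennreal (norm (k p)) \<partial>(lborel \<Otimes>\<^sub>M \<mu>)) = (\<integral>\<^sup>+y. \<integral>\<^sup>+x. ennreal (norm (k (x, y))) \<partial>lborel \<partial>\<mu>)"
    by (rule P.nn_integral_snd[symmetric]) simp
  also have "\<dots> \<le> (\<integral>\<^sup>+y. B \<partial>\<mu>)"
    by (rule nn_integral_mono_AE) (rule B)
  also have "\<dots> = B" by (simp add: emeasure_space_1)
  finally show "(\<integral>\<^sup>+p. ennreal (norm (k p)) \<partial>(lborel \<Otimes>\<^sub>M \<mu>)) < \<infinity>"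
    using B(2) by (rule le_less_trans)
qed simp

lemma average_integrable_pair:
  fixes f :: "'a::euclidean_space \<Rightarrow> real"
  assumes f: "locally_integrable f" and \<mu>: "bounded_prob \<mu>"
    and [measurable]: "h \<in> borel_measurable borel"
    and h: "\<And>x. \<bar>h x\<bar> \<le> C * indicator B x" and B: "bounded B"
  shows "integrable (lborel \<Otimes>\<^sub>M \<mu>) (\<lambda>(x, y). f (x + y) * h x)"
proof -
  have [measurable]: "f \<in> borel_measurable borel"
    by (rule locally_integrable_borel[OF f])
  have m: "(\<lambda>x. ennreal (\<bar>C\<bar> * (indicator (cball 0 r) x * \<bar>f x\<bar>))) \<in> borel_measurable borel" for r
    by (intro measurable_compose[OF _ measurable_ennreal] borel_measurable_times borel_measurable_abs
        borel_measurable_indicator borel_measurable_const) auto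
  obtain R where R: "AE y in \<mu>. norm y \<le> R" and "prob_space \<mu>"
    and [measurable_cong]: "sets \<mu> = sets borel"
    using \<mu> by (auto simp: bounded_prob_def)
  obtain r where r: "B \<subseteq> cball 0 r"
    using B by (auto simp: bounded_iff subset_eq)
  have "(\<lambda>x. indicator (cball 0 (r + R)) x * \<bar>f x\<bar>) = (\<lambda>x. norm (indicator (cball 0 (r + R)) x *\<^sub>R f x))"
    by (auto simp: abs_mult)
  then have int: "integrable lborel (\<lambda>x. indicator (cball 0 (r + R)) x * \<bar>f x\<bar>)"
    using f by (simp only: locally_integrable_def set_integrable_def integrable_norm)
  define b where "b = (\<integral>\<^sup>+x. ennreal (\<bar>C\<bar> * (indicator (cball 0 (r + R)) x * \<bar>f x\<bar>)) \<partial>lborel)"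
  have "b < \<infinity>"
    unfolding b_def
    by (subst nn_integral_eq_integral) (use int in auto)
  have "(\<integral>\<^sup>+x. ennreal (norm (f (x + y) * h x)) \<partial>lborel) \<le> b" if y: "norm y \<le> R" for y
  proof -
    have "norm (f (x + y) * h x) \<le> \<bar>C\<bar> * (indicator (cball 0 (r + R)) (x + y) * \<bar>f (x + y)\<bar>)" for x
    proof -
      have "\<bar>h x\<bar> \<le> \<bar>C\<bar> * indicator (cball 0 (r + R)) (x + y)"
      proof (cases "x \<in> B")
        case True
        then have "x + y \<in> cball 0 (r + R)"
          using r y norm_triangle_ineq[of x y] by force
        with h[of x] True show ?thesis by simp
      next
        case False
        with h[of x] show ?thesis by (auto simp: indicator_def)
      qed
      from mult_left_mono[OF this, of "\<bar>f (x + y)\<bar>"]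
      show ?thesis by (simp add: abs_mult mult_ac)
    qed
    then have "(\<integral>\<^sup>+x. ennreal (norm (f (x + y) * h x)) \<partial>lborel)
       \<le> (\<integral>\<^sup>+x. ennreal (\<bar>C\<bar> * (indicator (cball 0 (r + R)) (x + y) * \<bar>f (x + y)\<bar>)) \<partial>lborel)"
      by (intro nn_integral_mono ennreal_leI)
    also have "\<dots> = b"
      unfolding b_def
      by (rule nn_integral_lborel_shift[OF m])
    finally show ?thesis .
  qed
  then have "AE y in \<mu>. (\<integral>\<^sup>+x. ennreal (norm (f (x + y) * h x)) \<partial>lborel) \<le> b"
    using R by auto
  with \<open>b < \<infinity>\<close> \<open>prob_space \<mu>\<close> show ?thesis
    by (intro integrable_lborel_pairI[where B = b]) auto
qed

lemma average_Fubini: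
  fixes f :: "'a::euclidean_space \<Rightarrow> real"
  assumes f: "locally_integrable f" and \<mu>: "bounded_prob \<mu>"
    and hm: "h \<in> borel_measurable borel"
    and h: "\<And>x. \<bar>h x\<bar> \<le> C * indicator B x" and B: "bounded B"
  shows "(\<integral>x. (\<integral>y. f (x + y) \<partial>\<mu>) * h x \<partial>lborel) = (\<integral>y. \<integral>x. f (x + y) * h x \<partial>lborel \<partial>\<mu>)"
proof -
  interpret prob_space \<mu> using \<mu> by (simp add: bounded_prob_def)
  interpret P: pair_sigma_finite lborel \<mu> ..
  show ?thesis
    using P.Fubini_integral[OF average_integrable_pair[OF f \<mu> hm h B]] by simp
qed

lemma average_AE_integrable:
  fixes f :: "'a::euclidean_space \<Rightarrow> real"
  assumes f: "locally_integrable f" and \<mu>: "bounded_prob \<mu>"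
  shows "AE x in lborel. integrable \<mu> (\<lambda>y. f (x + y))"
proof -
  interpret prob_space \<mu> using \<mu> by (simp add: bounded_prob_def)
  interpret P: pair_sigma_finite lborel \<mu> ..
  have "AE x in lborel. integrable \<mu> (\<lambda>y. f (x + y) * indicator (cball 0 (real n)) x)" for n
    using P.AE_integrable_fst[OF average_integrable_pair[OF f \<mu> borel_measurable_indicator, of "cball 0 (real n)" 1 "cball 0 (real n)"]]
    by simp
  then have "AE x in lborel. \<forall>n. integrable \<mu> (\<lambda>y. f (x + y) * indicator (cball 0 (real n)) x)"
    unfolding AE_all_countable by blast
  then show ?thesis
  proof (rule AE_mp, intro AE_I2 impI)
    fix x assume *: "\<forall>n. integrable \<mu> (\<lambda>y. f (x + y) * indicator (cball 0 (real n)) x)"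
    obtain n where "norm x \<le> real n" using real_arch_simple by blast
    with *[rule_format, of n] show "integrable \<mu> (\<lambda>y. f (x + y))" by simp
  qed
qed

lemma average_locally_integrable:
  fixes f :: "'a::euclidean_space \<Rightarrow> real"
  assumes f: "locally_integrable f" and \<mu>: "bounded_prob \<mu>"
  shows "locally_integrable (\<lambda>x. \<integral>y. f (x + y) \<partial>\<mu>)"
proof -
  interpret prob_space \<mu> using \<mu> by (simp add: bounded_prob_def)
  interpret P: pair_sigma_finite lborel \<mu> ..
  have [measurable]: "f \<in> borel_measurable borel"
    by (rule locally_integrable_borel[OF f])
  have [measurable_cong]: "sets \<mu> = sets borel" using \<mu> by (simp add: bounded_prob_def)
  have "(\<lambda>x. \<integral>y. f (x + y) \<partial>\<mu>) \<in> borel_measurable lborel"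
    by measurable
  moreover have "set_integrable lborel (cball 0 r) (\<lambda>x. \<integral>y. f (x + y) \<partial>\<mu>)" for r
    using P.integrable_fst[OF average_integrable_pair[OF f \<mu> borel_measurable_indicator, of "cball 0 r" 1 "cball 0 r"]]
    by (simp add: set_integrable_def mult.commute)
  ultimately show ?thesis by (simp add: locally_integrable_def)
qed

section \<open>Increments are averages of the weak gradient along segments\<close>

text \<open>The distribution of \<open>t s\<close> for \<open>t\<close> uniform in the unit interval, that is, the uniform
  distribution on the segment from \<open>0\<close> to \<open>s\<close> (a point mass if \<open>s = 0\<close>).\<close>

definition segment_measure :: "'a::euclidean_space \<Rightarrow> 'a measure" where
  "segment_measure s = distr (uniform_measure lborel {0..1}) borel (\<lambda>t::real. t *\<^sub>R s)"

lemma bounded_prob_segment_measure: "bounded_prob (segment_measure s)"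
proof -
  interpret prob_space "uniform_measure lborel {0..1::real}"
    by (rule prob_space_uniform_measure) auto
  have "AE t in uniform_measure lborel {0..1}. norm (t *\<^sub>R s) \<le> norm s"
    by (rule AE_uniform_measureI) (auto intro!: AE_I2 mult_left_le_one_le)
  then have "AE y in segment_measure s. norm y \<le> norm s"
    unfolding segment_measure_def by (subst AE_distr_iff) auto
  then show ?thesis
    unfolding bounded_prob_def
    by (intro conjI exI[of _ "norm s"]) (auto simp: segment_measure_def intro!: prob_space_distr)
qed

lemma integral_segment_measure:
  assumes [measurable]: "f \<in> borel_measurable borel"
  shows "(\<integral>y. f y \<partial>segment_measure s) = (\<integral>t. f (t *\<^sub>R s) * indicator {0..1} t \<partial>lborel :: real)"
proof -
  have "uniform_measure lborel {0..1::real} = density lborel (\<lambda>t. ennreal (indicator {0..1} t))"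
    by (auto simp: uniform_measure_def ennreal_indicator divide_ennreal_def intro!: density_cong AE_I2)
  then show ?thesis
    by (simp add: segment_measure_def integral_distr integral_density mult.commute)
qed

text \<open>The fundamental theorem of calculus for a weak derivative \<open>g\<close> of \<open>u\<close> in direction \<open>s\<close>. Tested
  against a cut-off \<open>\<psi>\<close>, the translations move to \<open>\<psi>\<close>; there the classical theorem applies, and
  the derivative goes back to \<open>u\<close> as \<open>g\<close>, for each point of the segment separately.\<close>

lemma increment_eq_segment_average:
  fixes u g :: "real^'n \<Rightarrow> real"
  assumes u: "locally_integrable u" and g: "locally_integrable g"
    and weak: "\<And>k a b. (\<integral>x. u x * frechet_derivative (box_cutoff k a b) (at x) s \<partial>lborel) =
                        - (\<integral>x. g x * box_cutoff k a b x \<partial>lborel)"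
  shows "AE x in lborel. u (x + s) - u x = (\<integral>y. g (x + y) \<partial>segment_measure s)"
proof -
  let ?\<sigma> = "segment_measure s"
  have \<sigma>: "bounded_prob ?\<sigma>" by (rule bounded_prob_segment_measure)
  then interpret prob_space ?\<sigma> by (simp add: bounded_prob_def)
  interpret P: pair_sigma_finite lborel ?\<sigma> ..
  have [measurable_cong]: "sets ?\<sigma> = sets borel" by (simp add: segment_measure_def)
  have [measurable]: "u \<in> borel_measurable borel" "g \<in> borel_measurable borel"
    using u g by (auto dest: locally_integrable_borel)
  define f where "f x = (u (x + s) - u x) - (\<integral>y. g (x + y) \<partial>?\<sigma>)" for x
  have f: "locally_integrable f"
    unfolding f_def
    by (intro locally_integrable_diff locally_integrable_shift average_locally_integrable u g \<sigma>)
  then have [measurable]: "f \<in> borel_measurable borel" by (rule locally_integrable_borel)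
  have test: "(\<integral>x. f x * box_cutoff k a b x \<partial>lborel) = 0" for k a b
  proof -
    let ?\<psi> = "box_cutoff k a b"
    let ?D = "\<lambda>x. frechet_derivative ?\<psi> (at x) s"
    have [measurable]: "?\<psi> \<in> borel_measurable borel" "?D \<in> borel_measurable borel"
      by (intro borel_measurable_continuous_onI continuous_on_box_cutoff continuous_on_box_cutoff_derivative)+
    have \<psi>: "\<bar>?\<psi> x\<bar> \<le> 1 * indicator (box a b) x" for x
      using box_cutoff_bounds[of k a b x] box_cutoff_eq_0[of x a b k] by (auto simp: indicator_def)
    obtain C where C: "0 \<le> C" "\<And>x. \<bar>?D x\<bar> \<le> C * indicator (cbox a b) x"
      using box_cutoff_derivative_bound[of k a b s] by blast
    have bb: "bounded (box a b)" "box a b \<in> sets borel" "bounded (cbox a b)" "cbox a b \<in> sets borel"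
      by auto
    have D_shift: "?D (x - z) = frechet_derivative (box_cutoff k (a + z) (b + z)) (at x) s" for x z
    proof -
      have "((\<lambda>x. x - z) has_derivative (\<lambda>v. v)) (at x)"
        by (auto intro!: derivative_eq_intros)
      from has_derivative_compose[OF this box_cutoff_has_derivative]
      have "(box_cutoff k (a + z) (b + z) has_derivative frechet_derivative ?\<psi> (at (x - z))) (at x)"
        by (simp add: box_cutoff_translate[abs_def])
      from frechet_derivative_at[OF this] show ?thesis by simp
    qed
    have FTC: "?\<psi> (x - s) - ?\<psi> x = - (\<integral>z. ?D (x - z) \<partial>?\<sigma>)" for x
    proof -
      have "(\<integral>t. ?D (x - t *\<^sub>R s) * indicator {0..1} t \<partial>lborel) = (- ?\<psi> (x - 1 *\<^sub>R s)) - (- ?\<psi> (x - 0 *\<^sub>R s))"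
      proof (rule integral_FTC_Icc_real)
        show "isCont (\<lambda>t. ?D (x - t *\<^sub>R s)) t" for t
        proof -
          have "continuous_on UNIV (?D \<circ> (\<lambda>t. x - t *\<^sub>R s))"
            by (intro continuous_on_compose continuous_intros continuous_on_box_cutoff_derivative)
          then show ?thesis by (simp add: o_def continuous_on_eq_continuous_at)
        qed
        show "DERIV (\<lambda>t. - ?\<psi> (x - t *\<^sub>R s)) t :> ?D (x - t *\<^sub>R s)" for t
        proof -
          have "((\<lambda>t. x - t *\<^sub>R s) has_derivative (\<lambda>h. - (h *\<^sub>R s))) (at t)"
            by (auto intro!: derivative_eq_intros)
          from has_derivative_compose[OF this box_cutoff_has_derivative]
          have *: "((\<lambda>t. ?\<psi> (x - t *\<^sub>R s)) has_derivative
              (\<lambda>h. frechet_derivative ?\<psi> (at (x - t *\<^sub>R s)) (- (h *\<^sub>R s)))) (at t)" .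
          have lin: "linear (frechet_derivative ?\<psi> (at (x - t *\<^sub>R s)))"
            using box_cutoff_has_derivative has_derivative_linear by blast
          have "(\<lambda>h. - frechet_derivative ?\<psi> (at (x - t *\<^sub>R s)) (- (h *\<^sub>R s))) = (*) (?D (x - t *\<^sub>R s))"
            using linear_neg[OF lin] linear_scale[OF lin] by (auto simp: mult.commute)
          with has_derivative_minus[OF *] show ?thesis
            by (simp add: has_field_derivative_def)
        qed
      qed simp
      then show ?thesis
        by (subst integral_segment_measure) auto
    qed
    have shift_eq: "(\<integral>x. h (x + z) * ?\<psi> x \<partial>lborel) = (\<integral>x. h x * ?\<psi> (x - z) \<partial>lborel)"
      if [measurable]: "h \<in> borel_measurable borel" for h :: "real^'n \<Rightarrow> real" and z
      using integral_lborel_shift[of "\<lambda>x. h x * ?\<psi> (x - z)" z] by simp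
    \<comment> \<open>For Fubini's theorem: where the integrand is nonzero and \<open>z\<close> is on the segment, \<open>x\<close> lies in a fixed ball.\<close>
    have uD: "integrable (lborel \<Otimes>\<^sub>M ?\<sigma>) (\<lambda>(x, z). u x * ?D (x - z))"
    proof -
      obtain R where R: "AE z in ?\<sigma>. norm z \<le> R" using \<sigma> by (auto simp: bounded_prob_def)
      obtain r where r: "cbox a b \<subseteq> cball 0 r" using bounded_cbox[of a b] by (auto simp: bounded_iff subset_eq)
      let ?b = "\<integral>\<^sup>+x. ennreal (norm (C * (indicator (cball 0 (r + R)) x *\<^sub>R u x))) \<partial>lborel"
      have "integrable lborel (\<lambda>x. C * (indicator (cball 0 (r + R)) x *\<^sub>R u x))"
        using u by (auto simp: locally_integrable_def set_integrable_def)
      then have "?b < \<infinity>" by (auto simp only: integrable_iff_bounded)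
      moreover have "(\<integral>\<^sup>+x. ennreal (norm (u x * ?D (x - z))) \<partial>lborel) \<le> ?b" if z: "norm z \<le> R" for z
      proof (intro nn_integral_mono ennreal_leI)
        fix x
        have "\<bar>?D (x - z)\<bar> \<le> C * indicator (cball 0 (r + R)) x"
        proof (cases "x - z \<in> cbox a b")
          case True
          then have "x \<in> cball 0 (r + R)"
            using r z norm_triangle_ineq[of "x - z" z] by force
          with C(2)[of "x - z"] True show ?thesis by simp
        next
          case False
          with C(2)[of "x - z"] C(1) show ?thesis by simp
        qed
        from mult_left_mono[OF this, of "\<bar>u x\<bar>"]
        show "norm (u x * ?D (x - z)) \<le> norm (C * (indicator (cball 0 (r + R)) x *\<^sub>R u x))"
          using C(1) by (simp add: abs_mult mult_ac)
      qed
      ultimately show ?thesis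
        using R by (intro integrable_lborel_pairI[where B = ?b]) (auto intro: prob_space_axioms)
    qed
    have "(\<integral>x. (u (x + s) - u x) * ?\<psi> x \<partial>lborel) = (\<integral>x. u (x + s) * ?\<psi> x - u x * ?\<psi> x \<partial>lborel)"
      by (simp add: left_diff_distrib)
    also have "\<dots> = (\<integral>x. u (x + s) * ?\<psi> x \<partial>lborel) - (\<integral>x. u x * ?\<psi> x \<partial>lborel)"
      by (intro Bochner_Integration.integral_diff
          locally_integrable_mult_bounded[OF _ _ \<psi> bb(1,2)] locally_integrable_shift u) auto
    also have "\<dots> = (\<integral>x. u x * ?\<psi> (x - s) \<partial>lborel) - (\<integral>x. u x * ?\<psi> x \<partial>lborel)"
      by (simp add: shift_eq)
    also have "\<dots> = (\<integral>x. u x * ?\<psi> (x - s) - u x * ?\<psi> x \<partial>lborel)"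
    proof (intro Bochner_Integration.integral_diff[symmetric] locally_integrable_mult_bounded[OF u _ \<psi> bb(1,2)])
      have "\<bar>?\<psi> (x - s)\<bar> \<le> 1 * indicator (box (a + s) (b + s)) x" for x
        using box_cutoff_bounds[of k "a + s" "b + s" x] box_cutoff_eq_0[of x "a + s" "b + s" k]
        by (auto simp: indicator_def box_cutoff_translate)
      then show "integrable lborel (\<lambda>x. u x * ?\<psi> (x - s))"
        by (intro locally_integrable_mult_bounded[OF u]) (assumption | simp)+
    qed simp
    also have "\<dots> = (\<integral>x. - (u x * (\<integral>z. ?D (x - z) \<partial>?\<sigma>)) \<partial>lborel)"
      by (intro Bochner_Integration.integral_cong refl) (simp only: right_diff_distrib[symmetric] FTC mult_minus_right)
    also have "\<dots> = - (\<integral>x. \<integral>z. u x * ?D (x - z) \<partial>?\<sigma> \<partial>lborel)"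
      by simp
    also have "\<dots> = - (\<integral>z. \<integral>x. u x * ?D (x - z) \<partial>lborel \<partial>?\<sigma>)"
      using P.Fubini_integral[OF uD] by simp
    also have "\<dots> = (\<integral>z. \<integral>x. g x * ?\<psi> (x - z) \<partial>lborel \<partial>?\<sigma>)"
      by (simp add: D_shift weak box_cutoff_translate)
    also have "\<dots> = (\<integral>z. \<integral>x. g (x + z) * ?\<psi> x \<partial>lborel \<partial>?\<sigma>)"
      by (simp add: shift_eq)
    also have "\<dots> = (\<integral>x. (\<integral>z. g (x + z) \<partial>?\<sigma>) * ?\<psi> x \<partial>lborel)"
      by (rule average_Fubini[OF g \<sigma> _ \<psi> bb(1), symmetric]) simp
    finally have eq: "(\<integral>x. (u (x + s) - u x) * ?\<psi> x \<partial>lborel) = (\<integral>x. (\<integral>z. g (x + z) \<partial>?\<sigma>) * ?\<psi> x \<partial>lborel)" .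
    have "(\<integral>x. f x * ?\<psi> x \<partial>lborel) =
          (\<integral>x. (u (x + s) - u x) * ?\<psi> x - (\<integral>z. g (x + z) \<partial>?\<sigma>) * ?\<psi> x \<partial>lborel)"
      by (simp add: f_def left_diff_distrib)
    also have "\<dots> = (\<integral>x. (u (x + s) - u x) * ?\<psi> x \<partial>lborel) - (\<integral>x. (\<integral>z. g (x + z) \<partial>?\<sigma>) * ?\<psi> x \<partial>lborel)"
      by (intro Bochner_Integration.integral_diff
          locally_integrable_mult_bounded[OF _ _ \<psi> bb(1,2)] locally_integrable_shift
          locally_integrable_diff average_locally_integrable u g \<sigma>) auto
    finally show ?thesis by (simp add: eq)
  qed
  have "AE x in lborel. f x = 0"
  proof (rule AE_eq_0_if_box_integrals_eq_0[OF f])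
    fix a b :: "real^'n"
    have [measurable]: "box_cutoff k a b \<in> borel_measurable borel" for k
      by (intro borel_measurable_continuous_onI continuous_on_box_cutoff)
    have "(\<lambda>k. \<integral>x. f x * box_cutoff k a b x \<partial>lborel) \<longlonglongrightarrow> (\<integral>x. f x * indicator (box a b) x \<partial>lborel)"
    proof (rule integral_dominated_convergence[where w = "\<lambda>x. norm (f x * indicator (box a b) x)"])
      show "integrable lborel (\<lambda>x. norm (f x * indicator (box a b) x))"
        by (intro integrable_norm locally_integrable_mult_bounded[OF f, where C = 1 and B = "box a b"]) auto
      show "AE x in lborel. norm (f x * box_cutoff k a b x) \<le> norm (f x * indicator (box a b) x)" for k
        using box_cutoff_bounds[of k a b] box_cutoff_eq_0[of _ a b k]
        by (intro AE_I2) (auto simp: indicator_def abs_mult intro: mult_left_le)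
      show "AE x in lborel. (\<lambda>k. f x * box_cutoff k a b x) \<longlonglongrightarrow> f x * indicator (box a b) x"
        by (intro AE_I2 tendsto_intros box_cutoff_tendsto)
    qed auto
    then show "(LINT x:box a b|lborel. f x) = 0"
      by (simp add: test set_lebesgue_integral_def LIMSEQ_const_iff mult.commute)
  qed
  then show ?thesis
    by (rule AE_mp) (auto simp: f_def)
qed

section \<open>N-functions and the modular\<close>

lemma N_function_0: "N_function \<Phi> \<Longrightarrow> \<Phi> 0 = 0"
  and N_function_nonneg: "N_function \<Phi> \<Longrightarrow> 0 \<le> \<Phi> t"
  and N_function_abs: "N_function \<Phi> \<Longrightarrow> \<Phi> \<bar>t\<bar> = \<Phi> t"
  and N_function_convex: "N_function \<Phi> \<Longrightarrow> convex_on UNIV \<Phi>"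
  by (auto simp: N_function_def abs_if)

lemma N_function_borel:
  assumes "N_function \<Phi>" "f \<in> borel_measurable M"
  shows "(\<lambda>x. \<Phi> (f x)) \<in> borel_measurable M"
  using assms by (auto simp: N_function_def intro: borel_measurable_continuous_on)

lemma N_function_borel_ennreal:
  assumes "N_function \<Phi>" "f \<in> borel_measurable M"
  shows "(\<lambda>x. ennreal (\<Phi> (f x))) \<in> borel_measurable M"
  by (rule measurable_compose[OF N_function_borel[OF assms] measurable_ennreal])

lemma N_function_contract:
  assumes "N_function \<Phi>" "0 \<le> c" "c \<le> 1"
  shows "\<Phi> (c * t) \<le> c * \<Phi> t"
  using convex_onD[OF N_function_convex[OF assms(1)] assms(2,3), of 0 t] N_function_0[OF assms(1)] by simp

lemma N_function_mono:
  assumes N: "N_function \<Phi>" and "\<bar>s\<bar> \<le> \<bar>t\<bar>"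
  shows "\<Phi> s \<le> \<Phi> t"
proof (cases "t = 0")
  case False
  have "\<Phi> (\<bar>s\<bar> / \<bar>t\<bar> * \<bar>t\<bar>) \<le> \<bar>s\<bar> / \<bar>t\<bar> * \<Phi> \<bar>t\<bar>"
    by (rule N_function_contract[OF N]) (use assms(2) False in auto)
  also have "\<dots> \<le> 1 * \<Phi> \<bar>t\<bar>"
    by (rule mult_right_mono) (use assms(2) False N_function_nonneg[OF N] in auto)
  finally show ?thesis using False by (simp add: N_function_abs[OF N])
qed (use assms(2) in simp)

lemma N_function_mean2:
  assumes "N_function \<Phi>"
  shows "\<Phi> ((a + b) / 2) \<le> (\<Phi> a + \<Phi> b) / 2"
  using convex_onD[OF N_function_convex[OF assms], of "1/2" a b] by (simp add: field_simps)

lemma N_function_mean3: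
  assumes "N_function \<Phi>"
  shows "\<Phi> ((a + b + c) / 3) \<le> (\<Phi> a + \<Phi> b + \<Phi> c) / 3"
proof -
  have "\<Phi> ((1 - 1/3) *\<^sub>R ((a + b) / 2) + (1/3) *\<^sub>R c) \<le> (1 - 1/3) * \<Phi> ((a + b) / 2) + (1/3) * \<Phi> c"
    by (rule convex_onD[OF N_function_convex[OF assms]]) auto
  moreover have "(1 - 1/3) *\<^sub>R ((a + b) / 2) + (1/3) *\<^sub>R c = (a + b + c) / 3"
    by (simp add: field_simps)
  ultimately have "\<Phi> ((a + b + c) / 3) \<le> (1 - 1/3) * \<Phi> ((a + b) / 2) + (1/3) * \<Phi> c"
    by (simp only:)
  then show ?thesis
    using N_function_mean2[OF assms, of a b] by (simp add: field_simps)
qed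

lemma N_function_ge_linear:
  assumes N: "N_function \<Phi>"
  obtains T where "0 < T" "\<And>t. \<bar>t\<bar> \<le> T + \<Phi> t"
proof -
  have "filterlim (\<lambda>t. \<Phi> t / t) at_top at_top" using N by (simp add: N_function_def)
  then have "eventually (\<lambda>t. 1 \<le> \<Phi> t / t) at_top" by (simp add: filterlim_at_top)
  then obtain T0 where T0: "\<And>t. T0 \<le> t \<Longrightarrow> 1 \<le> \<Phi> t / t" by (auto simp: eventually_at_top_linorder)
  show thesis
  proof (rule that[of "max T0 1"])
    fix t
    show "\<bar>t\<bar> \<le> max T0 1 + \<Phi> t"
    proof (cases "\<bar>t\<bar> \<le> max T0 1")
      case True
      then show ?thesis using N_function_nonneg[OF N, of t] by linarith
    next
      case False
      then have "1 \<le> \<Phi> \<bar>t\<bar> / \<bar>t\<bar>" by (intro T0) auto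
      then have "\<bar>t\<bar> \<le> \<Phi> t"
        using False by (simp add: N_function_abs[OF N] le_divide_eq split: if_splits)
      then show ?thesis by linarith
    qed
  qed simp
qed

lemma N_function_unbounded:
  assumes N: "N_function \<Phi>"
  obtains L where "0 < L" "b < \<Phi> L"
proof -
  obtain T where T: "0 < T" "\<And>t. \<bar>t\<bar> \<le> T + \<Phi> t" by (rule N_function_ge_linear[OF N]) blast
  show thesis
    using T(1) T(2)[of "T + \<bar>b\<bar> + 1"] by (intro that[of "T + \<bar>b\<bar> + 1"]) auto
qed

lemma N_function_jensen:
  assumes N: "N_function \<Phi>" and "prob_space \<mu>" and f: "integrable \<mu> f"
  shows "ennreal (\<Phi> (\<integral>y. f y \<partial>\<mu>)) \<le> (\<integral>\<^sup>+y. ennreal (\<Phi> (f y)) \<partial>\<mu>)"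
proof (cases "(\<integral>\<^sup>+y. ennreal (\<Phi> (f y)) \<partial>\<mu>) < \<infinity>")
  case True
  interpret prob_space \<mu> by fact
  have "f \<in> borel_measurable \<mu>" using f by simp
  then have int: "integrable \<mu> (\<lambda>y. \<Phi> (f y))"
    using N_function_nonneg[OF N] by (intro integrableI_nonneg N_function_borel[OF N] AE_I2 True) auto
  have "\<Phi> (expectation f) \<le> expectation (\<lambda>y. \<Phi> (f y))"
    by (rule jensens_inequality[where I = UNIV]) (auto intro: f int N_function_convex[OF N])
  then show ?thesis
    by (subst nn_integral_eq_integral[OF int]) (auto simp: N_function_nonneg[OF N] intro: ennreal_leI)
next
  case False
  then have "(\<integral>\<^sup>+y. ennreal (\<Phi> (f y)) \<partial>\<mu>) = top"
    by (simp add: not_less top_unique)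
  then show ?thesis by simp
qed

lemma modular_mean2:
  assumes N: "N_function \<Phi>" and f: "f \<in> borel_measurable M" and g: "g \<in> borel_measurable M"
    and "0 \<le> m" "0 < c"
    and fm: "(\<integral>\<^sup>+x. ennreal (\<Phi> (f x / c)) \<partial>M) \<le> ennreal m"
    and gm: "(\<integral>\<^sup>+x. ennreal (\<Phi> (g x / c)) \<partial>M) \<le> ennreal m"
  shows "(\<integral>\<^sup>+x. ennreal (\<Phi> ((f x - g x) / (2 * c))) \<partial>M) \<le> ennreal m"
proof -
  have [measurable]: "f \<in> borel_measurable M" "g \<in> borel_measurable M" by fact+
  note [simp] = N_function_nonneg[OF N]
  have m: "(\<lambda>x. \<Phi> (f x / c)) \<in> borel_measurable M" "(\<lambda>x. \<Phi> (g x / c)) \<in> borel_measurable M"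
    by (intro N_function_borel[OF N]; measurable)+
  have "\<Phi> ((f x - g x) / (2 * c)) \<le> (\<Phi> (f x / c) + \<Phi> (g x / c)) / 2" for x
  proof -
    have "\<Phi> (- (g x / c)) = \<Phi> (g x / c)" using N by (simp add: N_function_def)
    moreover have "(f x - g x) / (2 * c) = (f x / c + - (g x / c)) / 2"
      using \<open>0 < c\<close> by (simp add: field_simps)
    ultimately show ?thesis
      using N_function_mean2[OF N, of "f x / c" "- (g x / c)"] by (simp only:)
  qed
  moreover have half: "ennreal (1/2) * (ennreal a + ennreal b) = ennreal ((a + b) / 2)"
    if "0 \<le> a" "0 \<le> b" for a b
    unfolding ennreal_plus[OF that, symmetric] using that by (subst ennreal_mult[symmetric]) auto
  ultimately have "(\<integral>\<^sup>+x. ennreal (\<Phi> ((f x - g x) / (2 * c))) \<partial>M)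
        \<le> (\<integral>\<^sup>+x. ennreal (1/2) * (ennreal (\<Phi> (f x / c)) + ennreal (\<Phi> (g x / c))) \<partial>M)"
    by (intro nn_integral_mono) (auto simp only: half N_function_nonneg[OF N] intro: ennreal_leI)
  also have "\<dots> = ennreal (1/2) * ((\<integral>\<^sup>+x. ennreal (\<Phi> (f x / c)) \<partial>M) + (\<integral>\<^sup>+x. ennreal (\<Phi> (g x / c)) \<partial>M))"
    using m by (subst nn_integral_cmult; (subst nn_integral_add)?) auto
  also have "\<dots> \<le> ennreal (1/2) * (ennreal m + ennreal m)"
    by (intro mult_left_mono add_mono fm gm) simp
  also have "\<dots> = ennreal m"
    using half[OF \<open>0 \<le> m\<close> \<open>0 \<le> m\<close>] by (simp only:) simp
  finally show ?thesis .
qed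

lemma modular_Fatou:
  assumes N: "N_function \<Phi>" and f: "\<And>n. f n \<in> borel_measurable M"
    and lim: "AE x in M. (\<lambda>n. f n x) \<longlonglongrightarrow> g x"
    and fm: "eventually (\<lambda>n. (\<integral>\<^sup>+x. ennreal (\<Phi> (f n x)) \<partial>M) \<le> m) sequentially"
  shows "(\<integral>\<^sup>+x. ennreal (\<Phi> (g x)) \<partial>M) \<le> m"
proof -
  have cont: "isCont \<Phi> t" for t
    using N by (simp add: N_function_def continuous_on_eq_continuous_at)
  have "AE x in M. ennreal (\<Phi> (g x)) = liminf (\<lambda>n. ennreal (\<Phi> (f n x)))"
    using lim
  proof eventually_elim
    case (elim x)
    then have "(\<lambda>n. ennreal (\<Phi> (f n x))) \<longlonglongrightarrow> ennreal (\<Phi> (g x))"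
      by (intro tendsto_ennrealI isCont_tendsto_compose[OF cont])
    then show ?case by (simp add: lim_imp_Liminf)
  qed
  then have "(\<integral>\<^sup>+x. ennreal (\<Phi> (g x)) \<partial>M) = (\<integral>\<^sup>+x. liminf (\<lambda>n. ennreal (\<Phi> (f n x))) \<partial>M)"
    by (rule nn_integral_cong_AE)
  also have "\<dots> \<le> liminf (\<lambda>n. \<integral>\<^sup>+x. ennreal (\<Phi> (f n x)) \<partial>M)"
    using N_function_borel[OF N f] by (intro nn_integral_liminf) auto
  also have "\<dots> \<le> limsup (\<lambda>n. \<integral>\<^sup>+x. ennreal (\<Phi> (f n x)) \<partial>M)"
    by (rule Liminf_le_Limsup) simp
  also have "\<dots> \<le> m"
    by (rule Limsup_bounded) (rule fm)
  finally show ?thesis .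
qed

text \<open>A Chebyshev estimate: if \<open>\<bar>f\<bar> \<ge> c L\<close> held on all of \<open>A\<close>, the modular would exceed \<open>m\<close>.\<close>

lemma modular_small_somewhere:
  assumes N: "N_function \<Phi>" and [measurable]: "A \<in> sets M" and "0 < c" "0 \<le> L"
    and fm: "(\<integral>\<^sup>+x. ennreal (\<Phi> (f x / c)) \<partial>M) \<le> m"
    and "m < ennreal (\<Phi> L) * emeasure M A"
  shows "\<exists>x\<in>A. \<bar>f x\<bar> < c * L"
proof (rule ccontr)
  assume "\<not> ?thesis"
  then have *: "c * L \<le> \<bar>f x\<bar>" if "x \<in> A" for x using that by (auto simp: not_less)
  have "ennreal (\<Phi> L) * emeasure M A = (\<integral>\<^sup>+x. ennreal (\<Phi> L) * indicator A x \<partial>M)"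
    by (simp add: nn_integral_cmult_indicator)
  also have "\<dots> \<le> (\<integral>\<^sup>+x. ennreal (\<Phi> (f x / c)) \<partial>M)"
  proof (intro nn_integral_mono)
    fix x
    show "ennreal (\<Phi> L) * indicator A x \<le> ennreal (\<Phi> (f x / c))"
    proof (cases "x \<in> A")
      case True
      have "\<Phi> L \<le> \<Phi> (f x / c)"
        using *[OF True] \<open>0 < c\<close> \<open>0 \<le> L\<close> by (intro N_function_mono[OF N]) (simp add: field_simps)
      with True show ?thesis by (simp add: ennreal_leI)
    qed simp
  qed
  also have "\<dots> \<le> m" by (rule fm)
  finally show False using assms(6) by simp
qed

section \<open>Modular bounds on increments and on deviations from ball averages\<close>

lemma nn_integral_average:
  fixes h :: "'a::euclidean_space \<Rightarrow> ennreal"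
  assumes [measurable]: "h \<in> borel_measurable borel" and \<mu>: "bounded_prob \<mu>"
  shows "(\<integral>\<^sup>+x. \<integral>\<^sup>+y. h (x + y) \<partial>\<mu> \<partial>lborel) = (\<integral>\<^sup>+x. h x \<partial>lborel)"
proof -
  interpret prob_space \<mu> using \<mu> by (simp add: bounded_prob_def)
  interpret P: pair_sigma_finite lborel \<mu> ..
  have [measurable_cong]: "sets \<mu> = sets borel" using \<mu> by (simp add: bounded_prob_def)
  have "(\<integral>\<^sup>+x. \<integral>\<^sup>+y. h (x + y) \<partial>\<mu> \<partial>lborel) = (\<integral>\<^sup>+y. \<integral>\<^sup>+x. h (x + y) \<partial>lborel \<partial>\<mu>)"
    by (rule P.Fubini'[symmetric]) measurable
  also have "\<dots> = (\<integral>\<^sup>+y. (\<integral>\<^sup>+x. h x \<partial>lborel) \<partial>\<mu>)"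
    by (simp add: nn_integral_lborel_shift)
  finally show ?thesis by (simp add: emeasure_space_1)
qed

text \<open>The form in which the gradient bound is used: a uniform bound, for increments of length at
  most \<open>c\<close>, on the modular of the increment divided by \<open>c\<close>.\<close>

definition increments_bounded :: "(real \<Rightarrow> real) \<Rightarrow> real \<Rightarrow> ('a::euclidean_space \<Rightarrow> real) \<Rightarrow> bool" where
  "increments_bounded \<Phi> m w \<longleftrightarrow>
     (\<forall>c s. 0 < c \<longrightarrow> norm s \<le> c \<longrightarrow>
        (\<integral>\<^sup>+x. ennreal (\<Phi> ((w (x + s) - w x) / c)) \<partial>lborel) \<le> ennreal m)"

lemma increments_boundedD:
  "increments_bounded \<Phi> m w \<Longrightarrow> 0 < c \<Longrightarrow> norm s \<le> c \<Longrightarrow>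
     (\<integral>\<^sup>+x. ennreal (\<Phi> ((w (x + s) - w x) / c)) \<partial>lborel) \<le> ennreal m"
  by (simp add: increments_bounded_def)

lemma increments_bounded_shift:
  assumes N: "N_function \<Phi>" and [measurable]: "w \<in> borel_measurable borel"
    and "increments_bounded \<Phi> m w"
  shows "increments_bounded \<Phi> m (\<lambda>x. w (x + z))"
  unfolding increments_bounded_def
proof (intro allI impI)
  fix c :: real and s :: 'a assume "0 < c" "norm s \<le> c"
  have m: "(\<lambda>x. ennreal (\<Phi> ((w (x + s) - w x) / c))) \<in> borel_measurable borel"
    by (rule N_function_borel_ennreal[OF N]) measurable
  have "(\<integral>\<^sup>+x. ennreal (\<Phi> ((w (x + s + z) - w (x + z)) / c)) \<partial>lborel) =
        (\<integral>\<^sup>+x. ennreal (\<Phi> ((w (x + s) - w x) / c)) \<partial>lborel)"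
    using nn_integral_lborel_shift[OF m, of z] by (simp add: ac_simps)
  then show "(\<integral>\<^sup>+x. ennreal (\<Phi> ((w (x + s + z) - w (x + z)) / c)) \<partial>lborel) \<le> ennreal m"
    using increments_boundedD[OF assms(3) \<open>0 < c\<close> \<open>norm s \<le> c\<close>] by simp
qed

text \<open>By Jensen's inequality on the segment and Tonelli's theorem, since an increment divided by
  \<open>c \<ge> \<bar>s\<bar>\<close> is at most an average of \<open>\<bar>G\<bar>\<close> along the segment.\<close>

lemma increments_bounded_of_weak_gradient:
  fixes u :: "real^'n \<Rightarrow> real" and G :: "real^'n \<Rightarrow> real^'n"
  assumes N: "N_function \<Phi>" and u: "locally_integrable u"
    and G: "\<And>i. locally_integrable (\<lambda>x. G x $ i)"
    and weak: "\<And>k a b i. (\<integral>x. u x * frechet_derivative (box_cutoff k a b) (at x) (axis i 1) \<partial>lborel) =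
                        - (\<integral>x. G x $ i * box_cutoff k a b x \<partial>lborel)"
    and Gm: "(\<integral>\<^sup>+x. ennreal (\<Phi> (norm (G x))) \<partial>lborel) \<le> ennreal m"
  shows "increments_bounded \<Phi> m u"
  unfolding increments_bounded_def
proof (intro allI impI)
  fix c :: real and s :: "real^'n"
  assume c: "0 < c" "norm s \<le> c"
  let ?\<sigma> = "segment_measure s"
  define g where "g x = (\<Sum>i\<in>UNIV. s $ i * G x $ i)" for x
  have [measurable]: "(\<lambda>x. G x $ i) \<in> borel_measurable borel" for i
    using G[of i] by (rule locally_integrable_borel)
  have [measurable]: "u \<in> borel_measurable borel" using u by (rule locally_integrable_borel)
  have [measurable]: "G \<in> borel_measurable borel"
  proof (rule borel_measurable_euclidean_space[THEN iffD2], rule ballI)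
    fix b :: "real^'n" assume "b \<in> Basis"
    then obtain i where b: "b = axis i 1" by (auto simp: Basis_vec_def)
    show "(\<lambda>x. G x \<bullet> b) \<in> borel_measurable borel" by (simp add: b inner_axis)
  qed
  have g: "locally_integrable g"
    unfolding g_def by (intro locally_integrable_sum locally_integrable_cmult G) simp
  have gs: "(\<integral>x. u x * frechet_derivative (box_cutoff k a b) (at x) s \<partial>lborel) =
                        - (\<integral>x. g x * box_cutoff k a b x \<partial>lborel)" for k a b
  proof -
    let ?D = "\<lambda>x. frechet_derivative (box_cutoff k a b) (at x)"
    have "?D x s = (\<Sum>i\<in>UNIV. s $ i * ?D x (axis i 1))" for x
    proof -
      have lin: "linear (?D x)"
        using box_cutoff_has_derivative has_derivative_linear by blast
      have "?D x s = ?D x (\<Sum>i\<in>UNIV. s $ i *\<^sub>R axis i 1)"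
        by (simp add: basis_expansion[of s, unfolded scalar_mult_eq_scaleR])
      also have "\<dots> = (\<Sum>i\<in>UNIV. s $ i * ?D x (axis i 1))"
        by (simp add: linear_sum[OF lin] linear_scale[OF lin])
      finally show ?thesis .
    qed
    then have "(\<integral>x. u x * ?D x s \<partial>lborel) = (\<integral>x. (\<Sum>i\<in>UNIV. s $ i * (u x * ?D x (axis i 1))) \<partial>lborel)"
      by (simp add: sum_distrib_left mult_ac)
    also have "\<dots> = (\<Sum>i\<in>UNIV. s $ i * (\<integral>x. u x * ?D x (axis i 1) \<partial>lborel))"
    proof (subst Bochner_Integration.integral_sum)
      fix i
      obtain C where "\<And>x. \<bar>?D x (axis i 1)\<bar> \<le> C * indicator (cbox a b) x"
        using box_cutoff_derivative_bound[of k a b "axis i 1"] by blast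
      then have "integrable lborel (\<lambda>x. u x * ?D x (axis i 1))"
        by (intro locally_integrable_mult_bounded[OF u, of _ C "cbox a b"]
             borel_measurable_continuous_onI continuous_on_box_cutoff_derivative) auto
      then show "integrable lborel (\<lambda>x. s $ i * (u x * ?D x (axis i 1)))" by simp
    qed simp
    also have "\<dots> = - (\<Sum>i\<in>UNIV. s $ i * (\<integral>x. G x $ i * box_cutoff k a b x \<partial>lborel))"
      by (simp add: weak sum_negf)
    also have "(\<Sum>i\<in>UNIV. s $ i * (\<integral>x. G x $ i * box_cutoff k a b x \<partial>lborel)) =
               (\<integral>x. (\<Sum>i\<in>UNIV. s $ i * (G x $ i * box_cutoff k a b x)) \<partial>lborel)"
    proof (subst Bochner_Integration.integral_sum)
      fix i
      have "\<bar>box_cutoff k a b x\<bar> \<le> 1 * indicator (box a b) x" for x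
        using box_cutoff_bounds[of k a b x] box_cutoff_eq_0[of x a b k] by (auto simp: indicator_def)
      then have "integrable lborel (\<lambda>x. G x $ i * box_cutoff k a b x)"
        by (intro locally_integrable_mult_bounded[OF G, of _ 1 "box a b"]
             borel_measurable_continuous_onI continuous_on_box_cutoff) auto
      then show "integrable lborel (\<lambda>x. s $ i * (G x $ i * box_cutoff k a b x))" by simp
    qed simp
    also have "\<dots> = (\<integral>x. g x * box_cutoff k a b x \<partial>lborel)"
      by (simp add: g_def sum_distrib_right mult.assoc)
    finally show ?thesis .
  qed
  have \<sigma>: "bounded_prob ?\<sigma>" by (rule bounded_prob_segment_measure)
  have "(\<integral>\<^sup>+x. ennreal (\<Phi> ((u (x + s) - u x) / c)) \<partial>lborel)
      \<le> (\<integral>\<^sup>+x. \<integral>\<^sup>+y. ennreal (\<Phi> (norm (G (x + y)))) \<partial>?\<sigma> \<partial>lborel)"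
  proof (rule nn_integral_mono_AE)
    show "AE x in lborel. ennreal (\<Phi> ((u (x + s) - u x) / c)) \<le> (\<integral>\<^sup>+y. ennreal (\<Phi> (norm (G (x + y)))) \<partial>?\<sigma>)"
      using increment_eq_segment_average[OF u g gs] average_AE_integrable[OF g \<sigma>]
    proof eventually_elim
      case (elim x)
      have "ennreal (\<Phi> ((u (x + s) - u x) / c)) = ennreal (\<Phi> (\<integral>y. g (x + y) / c \<partial>?\<sigma>))"
        by (simp add: elim(1))
      also have "\<dots> \<le> (\<integral>\<^sup>+y. ennreal (\<Phi> (g (x + y) / c)) \<partial>?\<sigma>)"
        using \<sigma> elim(2) by (intro N_function_jensen[OF N]) (auto simp: bounded_prob_def)
      also have "\<dots> \<le> (\<integral>\<^sup>+y. ennreal (\<Phi> (norm (G (x + y)))) \<partial>?\<sigma>)"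
      proof (intro nn_integral_mono ennreal_leI N_function_mono[OF N])
        fix y
        have "\<bar>g (x + y)\<bar> = \<bar>s \<bullet> G (x + y)\<bar>" by (simp add: g_def inner_vec_def)
        also have "\<dots> \<le> norm s * norm (G (x + y))" by (rule Cauchy_Schwarz_ineq2)
        also have "\<dots> \<le> c * norm (G (x + y))" using c by (intro mult_right_mono) auto
        finally show "\<bar>g (x + y) / c\<bar> \<le> \<bar>norm (G (x + y))\<bar>" using c by (simp add: field_simps)
      qed
      finally show ?case .
    qed
  qed
  also have "\<dots> = (\<integral>\<^sup>+x. ennreal (\<Phi> (norm (G x))) \<partial>lborel)"
    by (rule nn_integral_average[OF _ \<sigma>])
       (rule N_function_borel_ennreal[OF N], measurable)
  also note Gm
  finally show "(\<integral>\<^sup>+x. ennreal (\<Phi> ((u (x + s) - u x) / c)) \<partial>lborel) \<le> ennreal m" .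
qed

text \<open>The uniform distribution on the ball of radius \<open>h\<close> around \<open>0\<close>; meaningful for \<open>h > 0\<close>.\<close>

definition ball_measure :: "real \<Rightarrow> 'a::euclidean_space measure" where
  "ball_measure h = uniform_measure lborel (ball 0 h)"

text \<open>The mean of \<open>u\<close> over the ball of radius \<open>h\<close> around \<open>x\<close>.\<close>

definition ball_average :: "real \<Rightarrow> ('a::euclidean_space \<Rightarrow> real) \<Rightarrow> 'a \<Rightarrow> real" where
  "ball_average h u x = (\<integral>y. u (x + y) \<partial>ball_measure h)"

lemma ball_volume_pos: "0 < h \<Longrightarrow> 0 < measure lborel (ball (0::'a::euclidean_space) h)"
  using content_ball_pos[of h "0::'a"] by simp

lemma ball_measure_AE: "0 < h \<Longrightarrow> AE y in ball_measure h. norm y \<le> h"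
  unfolding ball_measure_def by (rule AE_uniform_measureI) auto

lemma sets_ball_measure [simp]: "sets (ball_measure h) = sets borel"
  by (simp add: ball_measure_def)

lemma bounded_prob_ball_measure:
  assumes "0 < h" shows "bounded_prob (ball_measure h :: 'a::euclidean_space measure)"
proof -
  have "emeasure lborel (ball (0::'a) h) \<noteq> 0"
    using ball_volume_pos[OF assms, where 'a = 'a] by (auto simp: measure_def)
  moreover have "emeasure lborel (ball (0::'a) h) < \<infinity>"
    by (intro emeasure_bounded_finite) simp
  ultimately have "prob_space (ball_measure h :: 'a measure)"
    unfolding ball_measure_def by (intro prob_space_uniform_measure) auto
  with ball_measure_AE[OF assms] show ?thesis
    by (auto simp: bounded_prob_def)
qed

lemma nn_integral_ball_measure:
  fixes g :: "'a::euclidean_space \<Rightarrow> ennreal"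
  assumes h: "0 < h" and [measurable]: "g \<in> borel_measurable borel"
  shows "(\<integral>\<^sup>+y. g y \<partial>ball_measure h) =
         ennreal (1 / measure lborel (ball (0::'a) h)) * (\<integral>\<^sup>+y. g y * indicator (ball 0 h) y \<partial>lborel)"
proof -
  have fin: "emeasure lborel (ball (0::'a) h) < \<infinity>"
    by (intro emeasure_bounded_finite) simp
  then have "emeasure lborel (ball (0::'a) h) = ennreal (measure lborel (ball (0::'a) h))"
    by (intro emeasure_eq_ennreal_measure) (simp add: less_top)
  moreover have "inverse (ennreal v) = ennreal (1 / v)" if "0 < v" for v
    using that by (simp add: inverse_ennreal divide_inverse)
  ultimately show ?thesis
    using ball_volume_pos[OF h, where 'a = 'a]
    by (simp add: ball_measure_def nn_integral_uniform_measure divide_ennreal_def mult.commute)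
qed

lemma ball_average_integrable:
  fixes u :: "'a::euclidean_space \<Rightarrow> real"
  assumes u: "locally_integrable u" and h: "0 < h"
  shows "integrable (ball_measure h) (\<lambda>y. u (x + y))"
proof -
  have us: "locally_integrable (\<lambda>y. u (y + x))" by (rule locally_integrable_shift[OF u])
  have [measurable]: "(\<lambda>y. u (y + x)) \<in> borel_measurable borel" by (rule locally_integrable_borel[OF us])
  have "set_integrable lborel (ball 0 h) (\<lambda>y. u (y + x))"
    by (rule locally_integrable_bounded[OF us]) auto
  then have "(\<integral>\<^sup>+y. ennreal (norm (indicator (ball 0 h) y *\<^sub>R u (y + x))) \<partial>lborel) < \<infinity>"
    by (auto simp only: set_integrable_def integrable_iff_bounded)
  also have "(\<lambda>y. ennreal (norm (indicator (ball 0 h) y *\<^sub>R u (y + x)))) =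
         (\<lambda>y. ennreal (norm (u (y + x))) * indicator (ball 0 h) y)"
    by (auto simp: indicator_def)
  finally have "(\<integral>\<^sup>+y. ennreal (norm (u (y + x))) \<partial>ball_measure h) < \<infinity>"
    by (subst nn_integral_ball_measure[OF h]) (auto simp: ennreal_mult_less_top)
  then show ?thesis
    by (intro integrableI_bounded) (auto simp: add.commute ball_measure_def)
qed

lemma ball_average_shift: "ball_average h (\<lambda>x. u (x + z)) x = ball_average h u (x + z)"
  by (simp add: ball_average_def ac_simps)

lemma ball_average_borel:
  assumes "locally_integrable u" "0 < h" shows "ball_average h u \<in> borel_measurable borel"
  using average_locally_integrable[OF assms(1) bounded_prob_ball_measure[OF assms(2)]]
  by (auto simp: ball_average_def[abs_def] dest: locally_integrable_borel)

text \<open>A Poincare inequality on the whole space: \<open>u\<close> is within distance \<open>O(h)\<close> of its ball average,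
  in the modular sense and with a constant that depends only on \<open>m\<close>.\<close>

lemma modular_ball_average_diff:
  fixes u :: "'a::euclidean_space \<Rightarrow> real"
  assumes N: "N_function \<Phi>" and u: "locally_integrable u" and inc: "increments_bounded \<Phi> m u"
    and h: "0 < h" "h \<le> c"
  shows "(\<integral>\<^sup>+x. ennreal (\<Phi> ((ball_average h u x - u x) / c)) \<partial>lborel) \<le> ennreal m"
proof -
  let ?\<mu> = "ball_measure h :: 'a measure"
  have \<mu>: "bounded_prob ?\<mu>" by (rule bounded_prob_ball_measure[OF h(1)])
  then interpret prob_space ?\<mu> by (simp add: bounded_prob_def)
  interpret P: pair_sigma_finite lborel ?\<mu> ..
  have [measurable]: "u \<in> borel_measurable borel" by (rule locally_integrable_borel[OF u])
  have [measurable_cong]: "sets ?\<mu> = sets borel" by simp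
  have m: "(\<lambda>(x, y). ennreal (\<Phi> ((u (x + y) - u x) / c))) \<in> borel_measurable (lborel \<Otimes>\<^sub>M ?\<mu>)"
    unfolding split_beta' by (rule N_function_borel_ennreal[OF N]) measurable
  have "(\<integral>\<^sup>+x. ennreal (\<Phi> ((ball_average h u x - u x) / c)) \<partial>lborel)
      \<le> (\<integral>\<^sup>+x. \<integral>\<^sup>+y. ennreal (\<Phi> ((u (x + y) - u x) / c)) \<partial>?\<mu> \<partial>lborel)"
  proof (rule nn_integral_mono)
    fix x
    have "(ball_average h u x - u x) / c = (\<integral>y. (u (x + y) - u x) / c \<partial>?\<mu>)"
      using ball_average_integrable[OF u h(1)] by (simp add: ball_average_def prob_space)
    then show "ennreal (\<Phi> ((ball_average h u x - u x) / c)) \<le> (\<integral>\<^sup>+y. ennreal (\<Phi> ((u (x + y) - u x) / c)) \<partial>?\<mu>)"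
      using ball_average_integrable[OF u h(1)]
      by (simp only:) (intro N_function_jensen[OF N prob_space_axioms] integrable_divide
          Bochner_Integration.integrable_diff integrable_const)
  qed
  also have "\<dots> = (\<integral>\<^sup>+y. \<integral>\<^sup>+x. ennreal (\<Phi> ((u (x + y) - u x) / c)) \<partial>lborel \<partial>?\<mu>)"
    using P.Fubini'[OF m] by simp
  also have "\<dots> \<le> (\<integral>\<^sup>+y. ennreal m \<partial>?\<mu>)"
  proof (rule nn_integral_mono_AE)
    show "AE y in ?\<mu>. (\<integral>\<^sup>+x. ennreal (\<Phi> ((u (x + y) - u x) / c)) \<partial>lborel) \<le> ennreal m"
      using ball_measure_AE[OF h(1)] by eventually_elim (use h in \<open>auto intro: increments_boundedD[OF inc]\<close>)
  qed
  also have "\<dots> = ennreal m" by (simp add: emeasure_space_1)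
  finally show ?thesis .
qed

lemma N_function_ball_average_le:
  fixes u :: "'a::euclidean_space \<Rightarrow> real"
  assumes N: "N_function \<Phi>" and u: "locally_integrable u" and h: "0 < h"
  shows "ennreal (\<Phi> (ball_average h u x / c)) \<le>
         ennreal (1 / measure lborel (ball (0::'a) h)) * (\<integral>\<^sup>+y. ennreal (\<Phi> (u y / c)) * indicator (ball x h) y \<partial>lborel)"
proof -
  let ?\<mu> = "ball_measure h :: 'a measure"
  have \<mu>: "bounded_prob ?\<mu>" by (rule bounded_prob_ball_measure[OF h(1)])
  then interpret prob_space ?\<mu> by (simp add: bounded_prob_def)
  have [measurable]: "u \<in> borel_measurable borel" by (rule locally_integrable_borel[OF u])
  have m: "(\<lambda>y. ennreal (\<Phi> (u y / c))) \<in> borel_measurable borel"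
      "(\<lambda>y. ennreal (\<Phi> (u (x + y) / c))) \<in> borel_measurable borel"
    by (rule N_function_borel_ennreal[OF N]; measurable)+
  have m': "(\<lambda>y. ennreal (\<Phi> (u y / c)) * indicator (ball x h) y) \<in> borel_measurable borel"
    using m(1) by (intro borel_measurable_times_ennreal borel_measurable_indicator) auto
  have "ball_average h u x / c = (\<integral>y. u (x + y) / c \<partial>?\<mu>)"
    by (simp add: ball_average_def)
  then have "ennreal (\<Phi> (ball_average h u x / c)) \<le> (\<integral>\<^sup>+y. ennreal (\<Phi> (u (x + y) / c)) \<partial>?\<mu>)"
    using ball_average_integrable[OF u h(1)]
    by (simp only:) (intro N_function_jensen[OF N prob_space_axioms] integrable_divide)
  also have "\<dots> = ennreal (1 / measure lborel (ball (0::'a) h)) *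
        (\<integral>\<^sup>+y. ennreal (\<Phi> (u (x + y) / c)) * indicator (ball 0 h) y \<partial>lborel)"
    by (rule nn_integral_ball_measure[OF h m(2)])
  also have "(\<integral>\<^sup>+y. ennreal (\<Phi> (u (x + y) / c)) * indicator (ball 0 h) y \<partial>lborel) =
        (\<integral>\<^sup>+y. ennreal (\<Phi> (u (y + x) / c)) * indicator (ball x h) (y + x) \<partial>lborel)"
    by (intro nn_integral_cong) (simp add: indicator_def dist_norm add.commute)
  also have "\<dots> = (\<integral>\<^sup>+y. ennreal (\<Phi> (u y / c)) * indicator (ball x h) y \<partial>lborel)"
    by (rule nn_integral_lborel_shift[OF m'])
  finally show ?thesis .
qed

lemma modular_ball_average:
  fixes u :: "'a::euclidean_space \<Rightarrow> real"
  assumes N: "N_function \<Phi>" and u: "locally_integrable u" and h: "0 < h"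
  shows "(\<integral>\<^sup>+x. ennreal (\<Phi> (ball_average h u x / c)) \<partial>lborel) \<le> (\<integral>\<^sup>+x. ennreal (\<Phi> (u x / c)) \<partial>lborel)"
proof -
  let ?\<mu> = "ball_measure h :: 'a measure"
  have \<mu>: "bounded_prob ?\<mu>" by (rule bounded_prob_ball_measure[OF h(1)])
  then interpret prob_space ?\<mu> by (simp add: bounded_prob_def)
  have [measurable]: "u \<in> borel_measurable borel" by (rule locally_integrable_borel[OF u])
  have "ennreal (\<Phi> (ball_average h u x / c)) \<le> (\<integral>\<^sup>+y. ennreal (\<Phi> (u (x + y) / c)) \<partial>?\<mu>)" for x
  proof -
    have "ball_average h u x / c = (\<integral>y. u (x + y) / c \<partial>?\<mu>)"
      by (simp add: ball_average_def)
    then show ?thesis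
      using ball_average_integrable[OF u h(1)]
      by (simp only:) (intro N_function_jensen[OF N prob_space_axioms] integrable_divide)
  qed
  then have "(\<integral>\<^sup>+x. ennreal (\<Phi> (ball_average h u x / c)) \<partial>lborel) \<le>
     (\<integral>\<^sup>+x. \<integral>\<^sup>+y. ennreal (\<Phi> (u (x + y) / c)) \<partial>?\<mu> \<partial>lborel)"
    by (intro nn_integral_mono)
  also have "\<dots> = (\<integral>\<^sup>+x. ennreal (\<Phi> (u x / c)) \<partial>lborel)"
    by (rule nn_integral_average[OF _ \<mu>])
       (rule N_function_borel_ennreal[OF N], measurable)
  finally show ?thesis .
qed

text \<open>The Lipschitz constant depends on \<open>h\<close> and \<open>m\<close>, but not on \<open>u\<close>. The increment of the
  average is the average of an increment, to which Jensen's inequality applies pointwise.\<close>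

lemma ball_average_Lipschitz:
  assumes N: "N_function \<Phi>" and h: "0 < h" and "0 \<le> m"
  obtains L where "0 < L"
    "\<And>u :: 'a::euclidean_space \<Rightarrow> real. \<And>x y. locally_integrable u \<Longrightarrow> increments_bounded \<Phi> m u \<Longrightarrow>
       \<bar>ball_average h u x - ball_average h u y\<bar> \<le> L * dist x y"
proof -
  let ?V = "measure lborel (ball (0::'a) h)"
  have V: "0 < ?V" by (rule ball_volume_pos[OF h])
  obtain L where L: "0 < L" "m / ?V < \<Phi> L" by (rule N_function_unbounded[OF N])
  show thesis
  proof (rule that[OF L(1)])
    fix u :: "'a \<Rightarrow> real" and x y
    assume u: "locally_integrable u" and inc: "increments_bounded \<Phi> m u"
    show "\<bar>ball_average h u x - ball_average h u y\<bar> \<le> L * dist x y"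
    proof (cases "x = y")
      case False
      define s where "s = x - y"
      define c where "c = norm s"
      have c: "0 < c" "norm s \<le> c" using False by (auto simp: c_def s_def)
      have us: "locally_integrable (\<lambda>z. u (z + s))" by (rule locally_integrable_shift[OF u])
      have d: "locally_integrable (\<lambda>z. u (z + s) - u z)"
        by (rule locally_integrable_diff[OF us u])
      have "ball_average h (\<lambda>z. u (z + s) - u z) y = ball_average h (\<lambda>z. u (z + s)) y - ball_average h u y"
        using ball_average_integrable[OF us h] ball_average_integrable[OF u h]
        unfolding ball_average_def by (intro Bochner_Integration.integral_diff) auto
      then have eq: "ball_average h (\<lambda>z. u (z + s) - u z) y = ball_average h u x - ball_average h u y"
        by (simp add: ball_average_shift) (simp add: s_def)
      have "ennreal (\<Phi> ((ball_average h u x - ball_average h u y) / c)) \<le>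
        ennreal (1 / ?V) * (\<integral>\<^sup>+z. ennreal (\<Phi> ((u (z + s) - u z) / c)) * indicator (ball y h) z \<partial>lborel)"
        using N_function_ball_average_le[OF N d h, of y c] by (simp add: eq)
      also have "\<dots> \<le> ennreal (1 / ?V) * (\<integral>\<^sup>+z. ennreal (\<Phi> ((u (z + s) - u z) / c)) \<partial>lborel)"
        by (intro mult_left_mono nn_integral_mono) (auto simp: indicator_def)
      also have "\<dots> \<le> ennreal (1 / ?V) * ennreal m"
        by (intro mult_left_mono increments_boundedD[OF inc c]) simp
      also have "\<dots> = ennreal (m / ?V)"
        using V \<open>0 \<le> m\<close> by (simp add: ennreal_mult[symmetric])
      finally have "\<Phi> ((ball_average h u x - ball_average h u y) / c) \<le> m / ?V"
        using V \<open>0 \<le> m\<close> by (simp add: ennreal_le_iff)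
      also have "\<dots> < \<Phi> L" by (rule L)
      finally have "\<not> \<bar>L\<bar> \<le> \<bar>(ball_average h u x - ball_average h u y) / c\<bar>"
        using N_function_mono[OF N] by (meson not_less)
      then show ?thesis
        using c L(1) by (simp add: field_simps c_def s_def dist_norm)
    qed simp
  qed
qed

section \<open>Bounds on ball averages\<close>

lemma ball_average_continuous:
  fixes u :: "'a::euclidean_space \<Rightarrow> real"
  assumes N: "N_function \<Phi>" and u: "locally_integrable u" and inc: "increments_bounded \<Phi> m u"
    and "0 < h" "0 \<le> m"
  shows "continuous_on UNIV (ball_average h u)"
proof -
  obtain L where L: "0 < L"
    "\<And>u :: 'a \<Rightarrow> real. \<And>x y. locally_integrable u \<Longrightarrow> increments_bounded \<Phi> m u \<Longrightarrow>
       \<bar>ball_average h u x - ball_average h u y\<bar> \<le> L * dist x y"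
    using ball_average_Lipschitz[OF N \<open>0 < h\<close> \<open>0 \<le> m\<close>, where 'a = 'a] by blast
  have "L-lipschitz_on UNIV (ball_average h u)"
    using L(2)[OF u inc] L(1) by (intro lipschitz_onI) (auto simp: dist_real_def)
  then show ?thesis by (rule lipschitz_on_continuous_on)
qed

lemma ball_averages_equi_Lipschitz:
  fixes w :: "nat \<Rightarrow> 'a::euclidean_space \<Rightarrow> real"
  assumes N: "N_function \<Phi>" and m: "0 \<le> m" and h: "0 < h"
    and w: "\<And>n. locally_integrable (w n)" and inc: "\<And>n. increments_bounded \<Phi> m (w n)"
  obtains L where "0 < L"
    "\<And>n x y. \<bar>ball_average h (w n) x - ball_average h (w n) y\<bar> \<le> L * dist x y"
proof -
  obtain L where L: "0 < L"
    "\<And>u :: 'a \<Rightarrow> real. \<And>x y. locally_integrable u \<Longrightarrow> increments_bounded \<Phi> m u \<Longrightarrow>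
       \<bar>ball_average h u x - ball_average h u y\<bar> \<le> L * dist x y"
    using ball_average_Lipschitz[OF N h m, where 'a = 'a] by blast
  show thesis by (rule that[OF L(1) L(2)[OF w inc]])
qed

text \<open>Where \<open>\<bar>u\<bar> > \<epsilon>\<close>, the average cannot deviate from \<open>u\<close> by \<open>\<epsilon>/2\<close> everywhere, as the modular of
  the deviation would be too large; so \<open>\<bar>ball_average h u\<bar>\<close> exceeds \<open>\<epsilon>/2\<close> somewhere. It is below
  \<open>\<epsilon>/2\<close> somewhere because \<open>u\<close> has a finite modular on a space of infinite measure. The value
  \<open>\<epsilon>/2\<close> is then attained by continuity.\<close>

lemma ball_average_attains_level:
  fixes u :: "'a::euclidean_space \<Rightarrow> real"
  assumes N: "N_function \<Phi>" and u: "locally_integrable u" and inc: "increments_bounded \<Phi> m u"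
    and h: "0 < h" and m: "0 \<le> m" and \<epsilon>: "0 < \<epsilon>"
    and \<alpha>: "0 < \<alpha>" and fin: "(\<integral>\<^sup>+x. ennreal (\<Phi> (u x / \<alpha>)) \<partial>lborel) < \<infinity>"
    and large: "ennreal m < ennreal (\<Phi> (\<epsilon> / (2 * h))) * emeasure lborel {x. \<epsilon> < \<bar>u x\<bar>}"
  shows "\<exists>x. \<bar>ball_average h u x\<bar> = \<epsilon> / 2"
proof -
  have [measurable]: "u \<in> borel_measurable borel" by (rule locally_integrable_borel[OF u])
  have "\<exists>x\<in>{x. \<epsilon> < \<bar>u x\<bar>}. \<bar>ball_average h u x - u x\<bar> < h * (\<epsilon> / (2 * h))"
    by (rule modular_small_somewhere[OF N _ _ _ modular_ball_average_diff[OF N u inc h order_refl] large])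
       (use h \<epsilon> in auto)
  then obtain x where "\<epsilon> < \<bar>u x\<bar>" "\<bar>ball_average h u x - u x\<bar> < \<epsilon> / 2" using h by auto
  then have x: "\<epsilon> / 2 < \<bar>ball_average h u x\<bar>" by linarith
  have "\<exists>y\<in>UNIV. \<bar>ball_average h u y\<bar> < \<alpha> * (\<epsilon> / (2 * \<alpha>))"
  proof (rule modular_small_somewhere[OF N _ _ _ modular_ball_average[OF N u h]])
    have "\<Phi> (\<epsilon> / (2 * \<alpha>)) \<noteq> 0" using N \<alpha> \<epsilon> by (simp add: N_function_def)
    then have "0 < \<Phi> (\<epsilon> / (2 * \<alpha>))" using N_function_nonneg[OF N, of "\<epsilon> / (2 * \<alpha>)"] by linarith
    then show "(\<integral>\<^sup>+x. ennreal (\<Phi> (u x / \<alpha>)) \<partial>lborel) < ennreal (\<Phi> (\<epsilon> / (2 * \<alpha>))) * emeasure lborel (UNIV :: 'a set)"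
      using fin by (simp add: ennreal_mult_top)
  qed (use \<alpha> \<epsilon> in auto)
  then obtain y where y: "\<bar>ball_average h u y\<bar> < \<epsilon> / 2" using \<alpha> by auto
  have "connected ((\<lambda>x. \<bar>ball_average h u x\<bar>) ` UNIV)"
    by (intro connected_continuous_image continuous_on_rabs ball_average_continuous[OF N u inc h m] connected_UNIV)
  then have "\<epsilon> / 2 \<in> (\<lambda>x. \<bar>ball_average h u x\<bar>) ` UNIV"
    using connectedD_interval[of "(\<lambda>x. \<bar>ball_average h u x\<bar>) ` UNIV" "\<bar>ball_average h u y\<bar>" "\<bar>ball_average h u x\<bar>" "\<epsilon> / 2"]
      x y by auto
  then show ?thesis by auto
qed

text \<open>Two averages at different scales both stay close to \<open>u\<close>, hence to each other, in the modular
  sense; this controls their difference at some point of the unit ball.\<close>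

lemma ball_averages_close_somewhere:
  assumes N: "N_function \<Phi>" and h: "0 < h" "0 < h'" and m: "0 \<le> m"
  obtains B where
    "\<And>u :: 'a::euclidean_space \<Rightarrow> real. locally_integrable u \<Longrightarrow> increments_bounded \<Phi> m u \<Longrightarrow>
       \<exists>p\<in>ball 0 1. \<bar>ball_average h u p - ball_average h' u p\<bar> < B"
proof -
  let ?V = "measure lborel (ball (0::'a) 1)"
  have V: "0 < ?V" by (rule ball_volume_pos) simp
  obtain L where L: "0 < L" "m / ?V < \<Phi> L" by (rule N_function_unbounded[OF N])
  define c where "c = max h h'"
  have c: "0 < c" "h \<le> c" "h' \<le> c" using h by (auto simp: c_def)
  show thesis
  proof (rule that)
    fix u :: "'a \<Rightarrow> real"
    assume u: "locally_integrable u" and inc: "increments_bounded \<Phi> m u"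
    have b: "(\<lambda>x. ball_average h u x - u x) \<in> borel_measurable lborel"
        "(\<lambda>x. ball_average h' u x - u x) \<in> borel_measurable lborel"
      using ball_average_borel[OF u h(1)] ball_average_borel[OF u h(2)] locally_integrable_borel[OF u]
      by auto
    have "(\<integral>\<^sup>+x. ennreal (\<Phi> (((ball_average h u x - u x) - (ball_average h' u x - u x)) / (2 * c))) \<partial>lborel) \<le> ennreal m"
      by (intro modular_mean2[OF N b] modular_ball_average_diff[OF N u inc] m h c)
    then have *: "(\<integral>\<^sup>+x. ennreal (\<Phi> ((ball_average h u x - ball_average h' u x) / (2 * c))) \<partial>lborel) \<le> ennreal m"
      by simp
    have "emeasure lborel (ball (0::'a) 1) = ennreal ?V"
      by (intro emeasure_eq_ennreal_measure) (use emeasure_bounded_finite[of "ball (0::'a) 1"] in auto)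
    moreover have "m < \<Phi> L * ?V" using L V by (simp add: field_simps)
    ultimately have "ennreal m < ennreal (\<Phi> L) * emeasure lborel (ball (0::'a) 1)"
      using V m N_function_nonneg[OF N, of L] by (simp add: ennreal_mult[symmetric] ennreal_less_iff)
    then show "\<exists>p\<in>ball 0 1. \<bar>ball_average h u p - ball_average h' u p\<bar> < 2 * c * L"
      using c L(1) by (intro modular_small_somewhere[OF N _ _ _ *]) auto
  qed
qed

text \<open>Averages at one scale \<open>h0\<close>, bounded at bounded points, bound the averages at every scale
  \<open>h\<close>: both are equi-Lipschitz, and they are close somewhere in the unit ball.\<close>

lemma ball_averages_bounded:
  fixes w :: "nat \<Rightarrow> 'a::euclidean_space \<Rightarrow> real"
  assumes N: "N_function \<Phi>" and m: "0 \<le> m"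
    and w: "\<And>n. locally_integrable (w n)" and inc: "\<And>n. increments_bounded \<Phi> m (w n)"
    and h0: "0 < h0" and p: "\<And>n. norm (p n) \<le> P" and anchor: "\<And>n. \<bar>ball_average h0 (w n) (p n)\<bar> \<le> \<eta>"
    and h: "0 < h"
  obtains C L where "0 \<le> L" "\<And>n x. \<bar>ball_average h (w n) x\<bar> \<le> C + L * norm x"
proof -
  obtain L0 where L0: "0 < L0"
    "\<And>n x y. \<bar>ball_average h0 (w n) x - ball_average h0 (w n) y\<bar> \<le> L0 * dist x y"
    by (rule ball_averages_equi_Lipschitz[where w = w, OF N m h0 w inc]) blast
  obtain L where L: "0 < L"
    "\<And>n x y. \<bar>ball_average h (w n) x - ball_average h (w n) y\<bar> \<le> L * dist x y"
    by (rule ball_averages_equi_Lipschitz[where w = w, OF N m h w inc]) blast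
  obtain B where B': "\<And>u :: 'a \<Rightarrow> real. locally_integrable u \<Longrightarrow> increments_bounded \<Phi> m u \<Longrightarrow>
       \<exists>q\<in>ball 0 1. \<bar>ball_average h u q - ball_average h0 u q\<bar> < B"
    using ball_averages_close_somewhere[OF N h h0 m, where 'a = 'a] by blast
  note B = B'[OF w inc]
  show thesis
  proof (rule that)
    fix n x
    obtain q where q: "norm q < 1" "\<bar>ball_average h (w n) q - ball_average h0 (w n) q\<bar> < B"
      using B[of n] by auto
    have "dist x q \<le> norm x + 1"
      using q(1) norm_triangle_ineq4[of x q] by (simp add: dist_norm)
    then have "L * dist x q \<le> L * (norm x + 1)" using L(1) by (intro mult_left_mono) auto
    moreover have "dist q (p n) \<le> 1 + P"
      using q(1) p[of n] norm_triangle_ineq4[of q "p n"] by (simp add: dist_norm)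
    then have "L0 * dist q (p n) \<le> L0 * (1 + P)" using L0(1) by (intro mult_left_mono) auto
    ultimately show "\<bar>ball_average h (w n) x\<bar> \<le> (\<eta> + L0 * (1 + P) + B + L) + L * norm x"
      using L(2)[of n x q] L0(2)[of n q "p n"] q(2) anchor[of n] by (simp add: algebra_simps)
  qed (use L in simp)
qed

section \<open>Compactness in the modular sense\<close>

text \<open>A diagonal sequence makes the averages converge for all scales and all points of a countable
  dense set; equicontinuity extends the convergence to all points.\<close>

lemma ball_averages_convergent_subsequence:
  fixes w :: "nat \<Rightarrow> 'a::euclidean_space \<Rightarrow> real" and h :: "nat \<Rightarrow> real"
  assumes N: "N_function \<Phi>" and m: "0 \<le> m"
    and w: "\<And>n. locally_integrable (w n)" and inc: "\<And>n. increments_bounded \<Phi> m (w n)"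
    and h: "\<And>k. 0 < h k"
    and bdd: "\<And>k n x. \<bar>ball_average (h k) (w n) x\<bar> \<le> C k + L k * norm x"
  obtains r where "strict_mono r" "\<And>k x. convergent (\<lambda>n. ball_average (h k) (w (r n)) x)"
proof -
  obtain D :: "'a set" where D: "countable D" "\<And>X. open X \<Longrightarrow> X \<noteq> {} \<Longrightarrow> \<exists>d\<in>D. d \<in> X"
    by (rule countable_dense_setE) blast
  \<comment> \<open>Dividing by the bound gives the uniform bound 1 that the diagonal argument needs.\<close>
  define b where "b k x = 1 + C k + L k * norm (x::'a)" for k x
  have b: "1 \<le> b k x" for k x
    using bdd[of k 0 x] by (simp add: b_def)
  define f where "f n = (\<lambda>(k, x). ball_average (h k) (w n) x / b k x)" for n
  have cnt: "countable ((UNIV :: nat set) \<times> D)" using D(1) by simp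
  have "norm (f n z) \<le> 1" for n z
  proof -
    obtain k x where z: "z = (k, x)" by (cases z)
    have "\<bar>ball_average (h k) (w n) x\<bar> \<le> b k x"
      using bdd[of k n x] by (simp add: b_def)
    then show ?thesis using b[of k x] by (simp add: f_def z)
  qed
  then obtain r where r: "strict_mono (r :: nat \<Rightarrow> nat)"
    "\<And>z. z \<in> UNIV \<times> D \<Longrightarrow> \<exists>l. (\<lambda>n. f (r n) z) \<longlonglongrightarrow> l"
    using function_convergent_subsequence[OF cnt, of f 1] by blast
  show thesis
  proof (rule that[OF r(1)])
    fix k x
    obtain K where K: "0 < K"
      "\<And>n x y. \<bar>ball_average (h k) (w n) x - ball_average (h k) (w n) y\<bar> \<le> K * dist x y"
      by (rule ball_averages_equi_Lipschitz[where w = w, OF N m h[of k] w inc]) blast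
    have "Cauchy (\<lambda>n. ball_average (h k) (w (r n)) x)"
    proof (rule metric_CauchyI)
      fix e :: real assume e: "0 < e"
      obtain d where d: "d \<in> D" "dist x d < e / (3 * K)"
        using D(2)[of "ball x (e / (3 * K))"] divide_pos_pos[OF e, of "3 * K"] K(1) by auto
      obtain l where "(\<lambda>n. f (r n) (k, d)) \<longlonglongrightarrow> l" using r(2)[of "(k, d)"] d(1) by auto
      then have "(\<lambda>n. f (r n) (k, d) * b k d) \<longlonglongrightarrow> l * b k d" by (intro tendsto_intros)
      then have "(\<lambda>n. ball_average (h k) (w (r n)) d) \<longlonglongrightarrow> l * b k d"
        using b[of k d] by (simp add: f_def)
      then have "Cauchy (\<lambda>n. ball_average (h k) (w (r n)) d)" by (rule LIMSEQ_imp_Cauchy)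
      then obtain n0 where n0: "\<And>i j. n0 \<le> i \<Longrightarrow> n0 \<le> j \<Longrightarrow>
          dist (ball_average (h k) (w (r i)) d) (ball_average (h k) (w (r j)) d) < e / 3"
        using e by (metis metric_CauchyD zero_less_divide_iff zero_less_numeral)
      have "K * dist x d < e / 3" using d(2) K(1) by (simp add: field_simps)
      then have close: "\<bar>ball_average (h k) (w i) x - ball_average (h k) (w i) d\<bar> < e / 3" for i
        using K(2)[of i x d] by linarith
      show "\<exists>n0. \<forall>i\<ge>n0. \<forall>j\<ge>n0.
          dist (ball_average (h k) (w (r i)) x) (ball_average (h k) (w (r j)) x) < e"
      proof (intro exI[of _ n0] allI impI)
        fix i j assume "n0 \<le> i" "n0 \<le> j"
        from n0[OF this] close[of "r i"] close[of "r j"]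
        show "dist (ball_average (h k) (w (r i)) x) (ball_average (h k) (w (r j)) x) < e"
          unfolding dist_real_def by linarith
      qed
    qed
    then show "convergent (\<lambda>n. ball_average (h k) (w (r n)) x)"
      by (simp add: Cauchy_convergent_iff)
  qed
qed

lemma modular_rescale:
  assumes N: "N_function \<Phi>" and [measurable]: "f \<in> borel_measurable M" and "0 \<le> m"
    and d: "0 < d" "d \<le> c" "d * m \<le> c"
    and fm: "(\<integral>\<^sup>+x. ennreal (\<Phi> (f x / d)) \<partial>M) \<le> ennreal m"
  shows "(\<integral>\<^sup>+x. ennreal (\<Phi> (f x / c)) \<partial>M) \<le> 1"
proof -
  have "\<Phi> (f x / c) \<le> (d / c) * \<Phi> (f x / d)" for x
    using N_function_contract[OF N, of "d / c" "f x / d"] d by simp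
  then have "(\<integral>\<^sup>+x. ennreal (\<Phi> (f x / c)) \<partial>M) \<le> (\<integral>\<^sup>+x. ennreal (d / c) * ennreal (\<Phi> (f x / d)) \<partial>M)"
    using d N_function_nonneg[OF N]
    by (intro nn_integral_mono) (simp add: ennreal_mult[symmetric] ennreal_leI)
  also have "\<dots> = ennreal (d / c) * (\<integral>\<^sup>+x. ennreal (\<Phi> (f x / d)) \<partial>M)"
    by (intro nn_integral_cmult N_function_borel_ennreal[OF N]) measurable
  also have "\<dots> \<le> ennreal (d / c) * ennreal m"
    by (intro mult_left_mono fm) simp
  also have "\<dots> = ennreal (d / c * m)" using d \<open>0 \<le> m\<close> by (subst ennreal_mult[symmetric]) auto
  also have "\<dots> \<le> 1" using d by (simp add: ennreal_le_1)
  finally show ?thesis .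
qed

lemma summable_telescope_convergent:
  fixes a :: "nat \<Rightarrow> real"
  assumes "summable b" "\<And>l. \<bar>a (Suc l) - a l\<bar> \<le> b l"
  shows "convergent a"
proof -
  have "summable (\<lambda>l. a (Suc l) - a l)"
    by (rule summable_comparison_test'[OF assms(1), of 0]) (use assms(2) in auto)
  then have "(\<lambda>n. \<Sum>l<n. a (Suc l) - a l) \<longlonglongrightarrow> (\<Sum>l. a (Suc l) - a l)" by (rule summable_LIMSEQ)
  then have "(\<lambda>n. a n - a 0) \<longlonglongrightarrow> (\<Sum>l. a (Suc l) - a l)" by (simp add: sum_lessThan_telescope)
  from tendsto_add[OF this tendsto_const[of "a 0"]] show ?thesis by (auto simp: convergent_def)
qed

text \<open>The weights \<open>2\<^sup>-\<^sup>k\<close> make the modulars summable, so the \<open>k\<close>-th modular density is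
  \<open>O(2\<^sup>k)\<close> almost everywhere. As \<open>\<Phi>\<close> grows at least linearly, the \<open>k\<close>-th increment is then
  \<open>O(2\<^sup>k 4\<^sup>-\<^sup>k)\<close>, which is summable.\<close>

lemma AE_convergent_of_modular_bounds:
  assumes N: "N_function \<Phi>" and a[measurable]: "\<And>k. a k \<in> borel_measurable M" and m: "0 \<le> m"
    and am: "\<And>k. (\<integral>\<^sup>+x. ennreal (\<Phi> ((a k x - a (Suc k) x) / (2 * (1/4) ^ k))) \<partial>M) \<le> ennreal m"
  shows "AE x in M. convergent (\<lambda>k. a k x)"
proof -
  let ?t = "\<lambda>k x. (a k x - a (Suc k) x) / (2 * (1/4) ^ k)"
  have meas: "(\<lambda>x. ennreal ((1/2) ^ k) * ennreal (\<Phi> (?t k x))) \<in> borel_measurable M" for k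
    by (intro borel_measurable_times_ennreal N_function_borel_ennreal[OF N]) measurable
  have sum: "(\<Sum>k. ennreal ((1/2) ^ k)) = ennreal (\<Sum>k. (1/2) ^ k)"
    by (rule suminf_ennreal2) auto
  have "(\<integral>\<^sup>+x. (\<Sum>k. ennreal ((1/2) ^ k) * ennreal (\<Phi> (?t k x))) \<partial>M) =
        (\<Sum>k. \<integral>\<^sup>+x. ennreal ((1/2) ^ k) * ennreal (\<Phi> (?t k x)) \<partial>M)"
    by (rule nn_integral_suminf) (rule meas)
  also have "\<dots> = (\<Sum>k. ennreal ((1/2) ^ k) * (\<integral>\<^sup>+x. ennreal (\<Phi> (?t k x)) \<partial>M))"
    by (intro suminf_cong nn_integral_cmult N_function_borel_ennreal[OF N]) measurable
  also have "\<dots> \<le> (\<Sum>k. ennreal ((1/2) ^ k) * ennreal m)"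
    by (intro suminf_le mult_left_mono am) auto
  also have "\<dots> = ennreal (\<Sum>k. (1/2) ^ k) * ennreal m"
    by (simp add: sum)
  also have "\<dots> < \<infinity>" by (simp add: ennreal_mult_less_top)
  finally have "AE x in M. (\<Sum>k. ennreal ((1/2) ^ k) * ennreal (\<Phi> (?t k x))) \<noteq> \<infinity>"
    using meas by (intro nn_integral_PInf_AE) auto
  then show ?thesis
  proof eventually_elim
    case (elim x)
    obtain C where C: "0 \<le> C" "(\<Sum>k. ennreal ((1/2) ^ k) * ennreal (\<Phi> (?t k x))) = ennreal C"
      using elim by (cases "\<Sum>k. ennreal ((1/2) ^ k) * ennreal (\<Phi> (?t k x))") auto
    obtain T where T: "0 < T" "\<And>t. \<bar>t\<bar> \<le> T + \<Phi> t" by (rule N_function_ge_linear[OF N]) blast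
    have bound: "(1/2) ^ k * \<Phi> (?t k x) \<le> C" for k
    proof -
      have "ennreal ((1/2) ^ k * \<Phi> (?t k x)) = (\<Sum>i\<in>{k}. ennreal ((1/2) ^ i) * ennreal (\<Phi> (?t i x)))"
        by (simp add: ennreal_mult N_function_nonneg[OF N])
      also have "\<dots> \<le> (\<Sum>k. ennreal ((1/2) ^ k) * ennreal (\<Phi> (?t k x)))"
        by (rule sum_le_suminf) auto
      finally show ?thesis using C by (simp add: ennreal_le_iff)
    qed
    show ?case
    proof (rule summable_telescope_convergent)
      show "summable (\<lambda>k. 2 * T * (1/4) ^ k + 2 * C * (1/2) ^ k)"
        by (intro summable_add summable_mult summable_geometric) auto
      fix k
      have "\<bar>a (Suc k) x - a k x\<bar> = 2 * (1/4) ^ k * \<bar>?t k x\<bar>"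
        by (simp add: abs_mult abs_minus_commute)
      also have "\<dots> \<le> 2 * (1/4) ^ k * (T + \<Phi> (?t k x))"
        by (intro mult_left_mono T) auto
      also have "\<dots> = 2 * T * (1/4) ^ k + 2 * (1/2) ^ k * ((1/2) ^ k * \<Phi> (?t k x))"
        by (simp add: algebra_simps flip: power_mult_distrib)
      also have "\<dots> \<le> 2 * T * (1/4) ^ k + 2 * (1/2) ^ k * C"
        by (intro add_left_mono mult_left_mono bound) auto
      finally show "\<bar>a (Suc k) x - a k x\<bar> \<le> 2 * T * (1/4) ^ k + 2 * C * (1/2) ^ k" by (simp add: mult_ac)
    qed
  qed
qed

text \<open>With \<open>A\<^sub>k\<close> the average at scale \<open>h\<^sub>k = 4\<^sup>-\<^sup>k\<close> and \<open>a\<^sub>k\<close> its limit along the subsequence,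
  the difference \<open>w\<^sub>n - v\<close> is split into \<open>w\<^sub>n - A\<^sub>k w\<^sub>n\<close> and \<open>a\<^sub>k - v\<close>, which are \<open>O(h\<^sub>k)\<close> in the
  modular sense uniformly in \<open>n\<close>, and \<open>A\<^sub>k w\<^sub>n - a\<^sub>k\<close>, which tends to 0 boundedly on bounded sets.
  The modular bound 1 is obtained for every \<open>c > 0\<close>; that is norm convergence, and no
  growth condition on \<open>\<Phi>\<close> enters.\<close>

theorem modular_compactness:
  fixes w :: "nat \<Rightarrow> 'a::euclidean_space \<Rightarrow> real"
  assumes N: "N_function \<Phi>" and m: "0 \<le> m"
    and w: "\<And>n. locally_integrable (w n)" and inc: "\<And>n. increments_bounded \<Phi> m (w n)"
    and h0: "0 < h0" and p: "\<And>n. norm (p n) \<le> P" and anchor: "\<And>n. \<bar>ball_average h0 (w n) (p n)\<bar> \<le> \<eta>"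
  obtains r v where "strict_mono r" "v \<in> borel_measurable borel"
    "\<And>c R. 0 < c \<Longrightarrow> eventually (\<lambda>n. (\<integral>\<^sup>+x. ennreal (\<Phi> ((w (r n) x - v x) / c)) * indicator (cball 0 R) x \<partial>lborel) \<le> 1) sequentially"
proof -
  define h :: "nat \<Rightarrow> real" where "h k = (1/4) ^ k" for k
  have h: "0 < h k" for k by (simp add: h_def)
  have "\<exists>C L. 0 \<le> L \<and> (\<forall>n x. \<bar>ball_average (h k) (w n) x\<bar> \<le> C + L * norm x)" for k
  proof -
    obtain C L where "0 \<le> L" "\<And>n x. \<bar>ball_average (h k) (w n) x\<bar> \<le> C + L * norm x"
      by (rule ball_averages_bounded[where w = w and p = p, OF N m w inc h0 p anchor h[of k]]) blast
    then show ?thesis by blast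
  qed
  then obtain C L where CL: "\<And>k. 0 \<le> L k" "\<And>k n x. \<bar>ball_average (h k) (w n) x\<bar> \<le> C k + L k * norm x"
    by metis
  obtain r where r: "strict_mono r" "\<And>k x. convergent (\<lambda>n. ball_average (h k) (w (r n)) x)"
    by (rule ball_averages_convergent_subsequence[where w = w and h = h and C = C and L = L, OF N m w inc h CL(2)]) blast
  define A where "A k n = ball_average (h k) (w (r n))" for k n
  define a where "a k x = lim (\<lambda>n. A k n x)" for k x
  have lim_a: "(\<lambda>n. A k n x) \<longlonglongrightarrow> a k x" for k x
    using r(2)[of k x] by (simp add: a_def A_def convergent_LIMSEQ_iff)
  have [measurable]: "w n \<in> borel_measurable borel" for n
    by (rule locally_integrable_borel[OF w])
  have [measurable]: "A k n \<in> borel_measurable borel" for k n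
    unfolding A_def by (rule ball_average_borel[OF w h])
  have [measurable]: "a k \<in> borel_measurable borel" for k
    by (rule borel_measurable_LIMSEQ_real[OF lim_a]) measurable
  have dev: "(\<integral>\<^sup>+x. ennreal (\<Phi> ((A k n x - w (r n) x) / c)) \<partial>lborel) \<le> ennreal m" if "h k \<le> c" for k n c
    unfolding A_def by (rule modular_ball_average_diff[OF N w inc h that])
  have diff: "(\<integral>\<^sup>+x. ennreal (\<Phi> ((a k x - a j x) / (2 * h k))) \<partial>lborel) \<le> ennreal m" if "k \<le> j" for k j
  proof (rule modular_Fatou[OF N, where f = "\<lambda>n x. (A k n x - A j n x) / (2 * h k)"])
    have "h j \<le> h k" using that by (simp add: h_def power_decreasing)
    then have "(\<integral>\<^sup>+x. ennreal (\<Phi> (((A k n x - w (r n) x) - (A j n x - w (r n) x)) / (2 * h k))) \<partial>lborel) \<le> ennreal m" for n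
      using h[of k] by (intro modular_mean2[OF N] dev m) auto
    then show "eventually (\<lambda>n. (\<integral>\<^sup>+x. ennreal (\<Phi> ((A k n x - A j n x) / (2 * h k))) \<partial>lborel) \<le> ennreal m) sequentially"
      by simp
    show "AE x in lborel. (\<lambda>n. (A k n x - A j n x) / (2 * h k)) \<longlonglongrightarrow> (a k x - a j x) / (2 * h k)"
      by (intro AE_I2 tendsto_intros lim_a) (use h[of k] in auto)
  qed measurable
  define v where "v x = lim (\<lambda>k. a k x)" for x
  have [measurable]: "v \<in> borel_measurable borel"
    unfolding v_def by measurable
  have "AE x in lborel. convergent (\<lambda>k. a k x)"
    by (rule AE_convergent_of_modular_bounds[OF N _ m]) (use diff[of _ "Suc _"] in \<open>auto simp: h_def\<close>)
  then have lim_v: "AE x in lborel. (\<lambda>k. a k x) \<longlonglongrightarrow> v x"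
    by (simp add: v_def convergent_LIMSEQ_iff)
  have dev_v: "(\<integral>\<^sup>+x. ennreal (\<Phi> ((a k x - v x) / (2 * h k))) \<partial>lborel) \<le> ennreal m" for k
  proof (rule modular_Fatou[OF N, where f = "\<lambda>j x. (a k x - a j x) / (2 * h k)"])
    show "eventually (\<lambda>j. (\<integral>\<^sup>+x. ennreal (\<Phi> ((a k x - a j x) / (2 * h k))) \<partial>lborel) \<le> ennreal m) sequentially"
      using eventually_ge_at_top[of k] by eventually_elim (rule diff)
    show "AE x in lborel. (\<lambda>j. (a k x - a j x) / (2 * h k)) \<longlonglongrightarrow> (a k x - v x) / (2 * h k)"
      using lim_v by eventually_elim (intro tendsto_intros, use h[of k] in auto)
  qed measurable
  show thesis
  proof (rule that[OF r(1)])
    show "v \<in> borel_measurable borel" by measurable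
    fix c R :: real assume c: "0 < c"
    let ?I = "indicator (cball 0 R) :: 'a \<Rightarrow> ennreal"
    \<comment> \<open>The three parts of the difference are estimated at scale \<open>c / 3\<close>.\<close>
    define d where "d = c / 3"
    have d: "0 < d" using c by (simp add: d_def)
    have "(\<lambda>k. (1/4 :: real) ^ k) \<longlonglongrightarrow> 0" by (rule LIMSEQ_realpow_zero) auto
    then have "eventually (\<lambda>k. (1/4 :: real) ^ k < d / (2 * (1 + m))) sequentially"
      using d m by (intro order_tendstoD) auto
    then obtain k where "(1/4 :: real) ^ k < d / (2 * (1 + m))"
      by (auto simp: eventually_sequentially)
    then have "2 * h k * (1 + m) < d" using m by (simp add: h_def field_simps)
    then have k: "2 * h k + 2 * h k * m < d" by (simp add: algebra_simps)
    have hm: "0 \<le> h k * m" using h[of k] m by simp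
    have k1: "h k \<le> d" "h k * m \<le> d" "2 * h k \<le> d" "2 * h k * m \<le> d"
      using k h[of k] hm by linarith+
    have 1: "(\<integral>\<^sup>+x. ennreal (\<Phi> ((A k n x - w (r n) x) / d)) \<partial>lborel) \<le> 1" for n
      by (rule modular_rescale[OF N _ m h k1(1,2) dev]) auto
    have 3: "(\<integral>\<^sup>+x. ennreal (\<Phi> ((a k x - v x) / d)) \<partial>lborel) \<le> 1"
      by (rule modular_rescale[OF N _ m _ k1(3,4) dev_v]) (use h in auto)
    have "(\<lambda>n. \<integral>\<^sup>+x. ennreal (\<Phi> ((A k n x - a k x) / d)) * ?I x \<partial>lborel) \<longlonglongrightarrow> (\<integral>\<^sup>+x. 0 \<partial>(lborel :: 'a measure))"
    proof (rule nn_integral_dominated_convergence[where w = "\<lambda>x. ennreal (\<Phi> (2 * (C k + L k * R) / d)) * ?I x"])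
      show "AE x in lborel. ennreal (\<Phi> ((A k n x - a k x) / d)) * ?I x \<le> ennreal (\<Phi> (2 * (C k + L k * R) / d)) * ?I x" for n
      proof (intro AE_I2)
        fix x :: 'a
        show "ennreal (\<Phi> ((A k n x - a k x) / d)) * ?I x \<le> ennreal (\<Phi> (2 * (C k + L k * R) / d)) * ?I x"
        proof (cases "x \<in> cball 0 R")
          case True
          then have le: "C k + L k * norm x \<le> C k + L k * R" using CL(1)[of k] by (simp add: mult_left_mono)
          have A_le: "\<bar>A k n x\<bar> \<le> C k + L k * R" for n using CL(2)[of k "r n" x] le by (simp add: A_def)
          have "\<bar>a k x\<bar> \<le> C k + L k * R"
            by (rule LIMSEQ_le_const2[OF tendsto_rabs[OF lim_a]]) (use A_le in auto)
          moreover have "\<bar>s - t\<bar> \<le> \<bar>2 * b\<bar>" if "\<bar>s\<bar> \<le> b" "\<bar>t\<bar> \<le> b" for s t b :: real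
            using that by linarith
          ultimately have "\<bar>A k n x - a k x\<bar> \<le> \<bar>2 * (C k + L k * R)\<bar>" using A_le[of n] by blast
          then have "\<Phi> ((A k n x - a k x) / d) \<le> \<Phi> (2 * (C k + L k * R) / d)"
            using d by (intro N_function_mono[OF N]) (simp add: divide_right_mono)
          then show ?thesis using True by (simp add: ennreal_leI)
        qed simp
      qed
      have "emeasure lborel (cball (0::'a) R) < \<infinity>" by (intro emeasure_bounded_finite) simp
      then show "(\<integral>\<^sup>+x. ennreal (\<Phi> (2 * (C k + L k * R) / d)) * ?I x \<partial>lborel) < \<infinity>"
        by (simp add: nn_integral_cmult_indicator ennreal_mult_less_top)
      show "AE x in lborel. (\<lambda>n. ennreal (\<Phi> ((A k n x - a k x) / d)) * ?I x) \<longlonglongrightarrow> 0"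
      proof (intro AE_I2)
        fix x :: 'a
        have "isCont \<Phi> t" for t
          using N by (simp add: N_function_def continuous_on_eq_continuous_at)
        moreover have "(\<lambda>n. (A k n x - a k x) / d) \<longlonglongrightarrow> (a k x - a k x) / d"
          by (intro tendsto_intros lim_a) (use d in simp)
        ultimately have "(\<lambda>n. ennreal (\<Phi> ((A k n x - a k x) / d))) \<longlonglongrightarrow> ennreal (\<Phi> ((a k x - a k x) / d))"
          by (intro tendsto_ennrealI isCont_tendsto_compose[of _ \<Phi>])
        then have "(\<lambda>n. ennreal (\<Phi> ((A k n x - a k x) / d))) \<longlonglongrightarrow> 0"
          by (simp add: N_function_0[OF N])
        then show "(\<lambda>n. ennreal (\<Phi> ((A k n x - a k x) / d)) * ?I x) \<longlonglongrightarrow> 0"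
          by (cases "x \<in> cball 0 R") auto
      qed
    qed (auto intro!: borel_measurable_times_ennreal borel_measurable_indicator N_function_borel_ennreal[OF N])
    then have "eventually (\<lambda>n. (\<integral>\<^sup>+x. ennreal (\<Phi> ((A k n x - a k x) / d)) * ?I x \<partial>lborel) < 1) sequentially"
      by (intro order_tendstoD) auto
    then show "eventually (\<lambda>n. (\<integral>\<^sup>+x. ennreal (\<Phi> ((w (r n) x - v x) / c)) * ?I x \<partial>lborel) \<le> 1) sequentially"
    proof eventually_elim
      case (elim n)
      let ?f1 = "\<lambda>x. ennreal (\<Phi> ((A k n x - w (r n) x) / d))"
      let ?f2 = "\<lambda>x. ennreal (\<Phi> ((A k n x - a k x) / d)) * ?I x"
      let ?f3 = "\<lambda>x. ennreal (\<Phi> ((a k x - v x) / d))"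
      have meas: "?f1 \<in> borel_measurable lborel" "?f2 \<in> borel_measurable lborel" "?f3 \<in> borel_measurable lborel"
        by (intro borel_measurable_times_ennreal borel_measurable_indicator N_function_borel_ennreal[OF N]; simp)+
      have third: "ennreal (1/3) * (ennreal s + ennreal t + ennreal u) = ennreal ((s + t + u) / 3)"
        if "0 \<le> s" "0 \<le> t" "0 \<le> u" for s t u
      proof -
        have "ennreal s + ennreal t + ennreal u = ennreal (s + t + u)"
          using that by simp
        then show ?thesis using that by (simp only:) (subst ennreal_mult[symmetric], auto)
      qed
      have "ennreal (\<Phi> ((w (r n) x - v x) / c)) * ?I x \<le> ennreal (1/3) * (?f1 x + ?f2 x + ?f3 x)" for x
      proof (cases "x \<in> cball 0 R")
        case True
        have "(w (r n) x - v x) / c =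
            (- ((A k n x - w (r n) x) / d) + (A k n x - a k x) / d + (a k x - v x) / d) / 3"
          using c by (simp add: d_def field_simps)
        moreover have "\<Phi> (- ((A k n x - w (r n) x) / d)) = \<Phi> ((A k n x - w (r n) x) / d)"
          using N by (simp add: N_function_def)
        ultimately have "\<Phi> ((w (r n) x - v x) / c) \<le>
            (\<Phi> ((A k n x - w (r n) x) / d) + \<Phi> ((A k n x - a k x) / d) + \<Phi> ((a k x - v x) / d)) / 3"
          using N_function_mean3[OF N, of "- ((A k n x - w (r n) x) / d)" "(A k n x - a k x) / d" "(a k x - v x) / d"]
          by (simp only:)
        then have "ennreal (\<Phi> ((w (r n) x - v x) / c)) \<le> ennreal (1/3) *
            (?f1 x + ennreal (\<Phi> ((A k n x - a k x) / d)) + ?f3 x)"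
          by (subst third) (auto simp: N_function_nonneg[OF N] intro: ennreal_leI)
        then show ?thesis using True by simp
      qed simp
      then have "(\<integral>\<^sup>+x. ennreal (\<Phi> ((w (r n) x - v x) / c)) * ?I x \<partial>lborel) \<le>
          (\<integral>\<^sup>+x. ennreal (1/3) * (?f1 x + ?f2 x + ?f3 x) \<partial>lborel)"
        by (intro nn_integral_mono)
      also have "\<dots> = ennreal (1/3) * ((\<integral>\<^sup>+x. ?f1 x \<partial>lborel) + (\<integral>\<^sup>+x. ?f2 x \<partial>lborel) + (\<integral>\<^sup>+x. ?f3 x \<partial>lborel))"
        using meas by (subst nn_integral_cmult; (subst nn_integral_add)?; (subst nn_integral_add)?) auto
      also have "\<dots> \<le> ennreal (1/3) * (ennreal 1 + ennreal 1 + ennreal 1)"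
        using 1[of n] 3 elim by (intro mult_left_mono add_mono) auto
      also have "\<dots> = 1" by (subst third) auto
      finally show ?case .
    qed
  qed
qed

text \<open>If the limit vanished, the modular of \<open>w\<^sub>n / c\<close> on a fixed ball would eventually be at most 1 for
  every \<open>c\<close>, and Jensen's inequality would bound \<open>\<Phi>(\<eta> / c)\<close> by a constant independent of \<open>c\<close>.\<close>

lemma modular_limit_nontrivial:
  fixes w :: "nat \<Rightarrow> 'a::euclidean_space \<Rightarrow> real"
  assumes N: "N_function \<Phi>" and w: "\<And>n. locally_integrable (w n)"
    and h0: "0 < h0" and p: "\<And>n. norm (p n) \<le> P" and \<eta>: "0 < \<eta>"
    and anchor: "\<And>n. \<bar>ball_average h0 (w n) (p n)\<bar> = \<eta>"
    and conv: "\<And>c R. 0 < c \<Longrightarrow> eventually (\<lambda>n. (\<integral>\<^sup>+x. ennreal (\<Phi> ((w (r n) x - v x) / c)) * indicator (cball 0 R) x \<partial>lborel) \<le> 1) sequentially"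
  shows "\<not> (AE x in lborel. v x = 0)"
proof
  assume v0: "AE x in lborel. v x = 0"
  let ?V = "measure lborel (ball (0::'a) h0)"
  have V: "0 < ?V" by (rule ball_volume_pos[OF h0])
  obtain L where L: "0 < L" "1 / ?V < \<Phi> L" by (rule N_function_unbounded[OF N])
  define c where "c = \<eta> / L"
  have c: "0 < c" using \<eta> L by (simp add: c_def)
  obtain n where n: "(\<integral>\<^sup>+x. ennreal (\<Phi> ((w (r n) x - v x) / c)) * indicator (cball 0 (P + h0)) x \<partial>lborel) \<le> 1"
    using conv[OF c, of "P + h0"] by (auto simp: eventually_sequentially)
  have "ennreal (\<Phi> (ball_average h0 (w (r n)) (p (r n)) / c)) \<le>
      ennreal (1 / ?V) * (\<integral>\<^sup>+y. ennreal (\<Phi> (w (r n) y / c)) * indicator (ball (p (r n)) h0) y \<partial>lborel)"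
    by (rule N_function_ball_average_le[OF N w h0])
  also have "\<dots> \<le> ennreal (1 / ?V) *
      (\<integral>\<^sup>+x. ennreal (\<Phi> ((w (r n) x - v x) / c)) * indicator (cball 0 (P + h0)) x \<partial>lborel)"
  proof (intro mult_left_mono nn_integral_mono_AE)
    have sub: "x \<in> cball 0 (P + h0)" if "x \<in> ball (p (r n)) h0" for x
      using that p[of "r n"] norm_triangle_ineq[of "p (r n)" "x - p (r n)"]
      by (simp add: dist_norm norm_minus_commute)
    show "AE x in lborel. ennreal (\<Phi> (w (r n) x / c)) * indicator (ball (p (r n)) h0) x \<le>
        ennreal (\<Phi> ((w (r n) x - v x) / c)) * indicator (cball 0 (P + h0)) x"
      using v0 by eventually_elim (use sub in \<open>auto simp: indicator_def\<close>)
  qed simp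
  also have "\<dots> \<le> ennreal (1 / ?V) * 1" by (intro mult_left_mono n) simp
  finally have "\<Phi> (ball_average h0 (w (r n)) (p (r n)) / c) \<le> 1 / ?V"
    using V by (simp add: ennreal_le_iff)
  moreover have "\<Phi> L \<le> \<Phi> (ball_average h0 (w (r n)) (p (r n)) / c)"
    using anchor[of "r n"] \<eta> L(1) by (intro N_function_mono[OF N]) (simp add: c_def abs_mult)
  ultimately show False using L(2) by linarith
qed

section \<open>Borel representatives and the Luxemburg norm\<close>

lemma L1_loc_borel_representative:
  fixes f :: "real^'n \<Rightarrow> real"
  assumes "f \<in> L1_loc UNIV"
  obtains g where "locally_integrable g" "AE x in lborel. f x = g x" "f \<in> borel_measurable lebesgue"
proof -
  have f: "set_integrable lebesgue (cball 0 r) f" for r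
    using assms by (simp add: L1_loc_def)
  have fm: "f \<in> borel_measurable lebesgue"
  proof (rule borel_measurable_LIMSEQ_real)
    fix x :: "real^'n"
    obtain n0 where n0: "norm x \<le> real n0" using real_arch_simple by blast
    have "eventually (\<lambda>n. indicator (cball 0 (real n)) x *\<^sub>R f x = f x) sequentially"
      using eventually_ge_at_top[of n0] by eventually_elim (use n0 in auto)
    then show "(\<lambda>n. indicator (cball 0 (real n)) x *\<^sub>R f x) \<longlonglongrightarrow> f x"
      by (rule tendsto_eventually)
  next
    show "(\<lambda>x. indicator (cball 0 (real n)) x *\<^sub>R f x) \<in> borel_measurable lebesgue" for n
      using f[of "real n"] unfolding set_integrable_def by (rule borel_measurable_integrable)
  qed
  then obtain g where g[measurable]: "g \<in> borel_measurable lborel" and fg: "AE x in lborel. f x = g x"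
    using completion_ex_borel_measurable_real by blast
  have "set_integrable lborel (cball 0 r) g" for r
  proof -
    have gl: "(\<lambda>x. indicator (cball 0 r) x *\<^sub>R g x) \<in> borel_measurable lborel"
      using g by (intro borel_measurable_scaleR borel_measurable_indicator) auto
    have "integrable lebesgue (\<lambda>x. indicator (cball 0 r) x *\<^sub>R g x)"
    proof (rule Bochner_Integration.integrable_cong_AE_imp[OF f[of r, unfolded set_integrable_def]])
      show "(\<lambda>x. indicator (cball 0 r) x *\<^sub>R g x) \<in> borel_measurable lebesgue"
        by (rule measurable_completion[OF gl])
      show "AE x in lebesgue. indicator (cball 0 r) x *\<^sub>R f x = indicator (cball 0 r) x *\<^sub>R g x"
        unfolding AE_completion_iff using fg by eventually_elim simp
    qed
    then show ?thesis
      using integrable_completion[OF gl] by (simp only: set_integrable_def)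
  qed
  then show thesis
    using g fg fm by (intro that[of g]) (auto simp: locally_integrable_def)
qed

lemma integral_lebesgue_eq_lborel:
  fixes f g h :: "real^'n \<Rightarrow> real"
  assumes fm: "f \<in> borel_measurable lebesgue" and gm: "g \<in> borel_measurable borel"
    and fg: "AE x in lborel. f x = g x" and hm: "h \<in> borel_measurable borel"
  shows "(LINT x:UNIV|lebesgue. f x * h x) = (\<integral>x. g x * h x \<partial>lborel)"
proof -
  have hl: "h \<in> borel_measurable lebesgue" and gl: "g \<in> borel_measurable lebesgue"
    using hm gm by (auto intro: measurable_completion)
  have "(LINT x:UNIV|lebesgue. f x * h x) = (\<integral>x. f x * h x \<partial>lebesgue)"
    by (simp add: set_lebesgue_integral_def)
  also have "\<dots> = (\<integral>x. g x * h x \<partial>lebesgue)"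
    using fm gl hl fg
    by (intro integral_cong_AE borel_measurable_times) (auto simp: AE_completion_iff elim: eventually_mono)
  also have "\<dots> = (\<integral>x. g x * h x \<partial>lborel)"
    using gm hm by (intro integral_completion) auto
  finally show ?thesis .
qed

text \<open>The nonnegative integral with respect to a completed measure agrees with the one with
  respect to the original measure for all functions, so no measurability is needed.\<close>

lemma modular_eq_nn_integral:
  assumes "N_function \<Phi>"
  shows "modular \<Phi> \<Omega> f = (\<integral>\<^sup>+x. ennreal (\<Phi> (f x)) * indicator \<Omega> x \<partial>lborel)"
  by (simp add: modular_def nn_integral_completion N_function_abs[OF assms])

text \<open>The weak derivative is fixed by a choice operator, so its defining property is available only
  through the existence part of membership in the Sobolev space.\<close>

lemma orlicz_sobolev_representative:
  fixes u :: "real^'n \<Rightarrow> real"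
  assumes N: "N_function \<Phi>" and u: "u \<in> orlicz_sobolev_space \<Phi> UNIV"
    and gm: "modular \<Phi> UNIV (\<lambda>x. norm (weak_grad UNIV u x)) \<le> ennreal m"
  obtains u' \<alpha> where "locally_integrable u'" "AE x in lborel. u x = u' x" "u \<in> borel_measurable lebesgue"
    "increments_bounded \<Phi> m u'" "0 < \<alpha>" "(\<integral>\<^sup>+x. ennreal (\<Phi> (u' x / \<alpha>)) \<partial>lborel) < \<infinity>"
proof -
  have wd: "is_weak_pderiv UNIV i u (weak_pderiv UNIV i u)" for i
  proof -
    have "\<exists>g. is_weak_pderiv UNIV i u g" using u by (auto simp: orlicz_sobolev_space_def)
    then show ?thesis unfolding weak_pderiv_def by (rule someI_ex)
  qed
  have uL: "u \<in> L1_loc UNIV" using wd[of undefined] by (simp add: is_weak_pderiv_def)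
  obtain u' where u': "locally_integrable u'" "AE x in lborel. u x = u' x" "u \<in> borel_measurable lebesgue"
    using L1_loc_borel_representative[OF uL] by blast
  have "\<exists>g. locally_integrable g \<and> (AE x in lborel. weak_pderiv UNIV i u x = g x) \<and>
          weak_pderiv UNIV i u \<in> borel_measurable lebesgue" for i
  proof -
    have "weak_pderiv UNIV i u \<in> L1_loc UNIV" using wd[of i] by (simp add: is_weak_pderiv_def)
    then show ?thesis using L1_loc_borel_representative by metis
  qed
  then obtain g where g: "\<And>i. locally_integrable (g i)" "\<And>i. AE x in lborel. weak_pderiv UNIV i u x = g i x"
      "\<And>i. weak_pderiv UNIV i u \<in> borel_measurable lebesgue"
    by metis
  define G where "G x = (\<chi> i. g i x)" for x
  have "AE x in lborel. \<forall>i\<in>UNIV. weak_pderiv UNIV i u x = g i x"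
    by (intro AE_finite_allI g) simp
  then have grad: "AE x in lborel. weak_grad UNIV u x = G x"
    by eventually_elim (simp add: weak_grad_def G_def)
  have "increments_bounded \<Phi> m u'"
  proof (rule increments_bounded_of_weak_gradient[OF N u'(1), where G = G])
    show "locally_integrable (\<lambda>x. G x $ i)" for i
      using g(1)[of i] by (simp add: G_def)
    have "(\<integral>\<^sup>+x. ennreal (\<Phi> (norm (G x))) \<partial>lborel) = (\<integral>\<^sup>+x. ennreal (\<Phi> (norm (weak_grad UNIV u x))) \<partial>lborel)"
      by (rule nn_integral_cong_AE) (use grad in eventually_elim, simp)
    also have "\<dots> \<le> ennreal m"
      using gm by (simp add: modular_eq_nn_integral[OF N])
    finally show "(\<integral>\<^sup>+x. ennreal (\<Phi> (norm (G x))) \<partial>lborel) \<le> ennreal m" .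
    fix k i and a b :: "real^'n"
    let ?\<psi> = "box_cutoff k a b"
    have "(LINT x:UNIV|lebesgue. u x * frechet_derivative ?\<psi> (at x) (axis i 1)) =
          - (LINT x:UNIV|lebesgue. weak_pderiv UNIV i u x * ?\<psi> x)"
      using wd[of i] box_cutoff_test_function[of k a b] unfolding is_weak_pderiv_def by blast
    moreover have "(LINT x:UNIV|lebesgue. u x * frechet_derivative ?\<psi> (at x) (axis i 1)) =
          (\<integral>x. u' x * frechet_derivative ?\<psi> (at x) (axis i 1) \<partial>lborel)"
      by (intro integral_lebesgue_eq_lborel u' locally_integrable_borel
          borel_measurable_continuous_onI continuous_on_box_cutoff_derivative)
    moreover have "(LINT x:UNIV|lebesgue. weak_pderiv UNIV i u x * ?\<psi> x) = (\<integral>x. g i x * ?\<psi> x \<partial>lborel)"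
      by (intro integral_lebesgue_eq_lborel g locally_integrable_borel
          borel_measurable_continuous_onI continuous_on_box_cutoff)
    ultimately show "(\<integral>x. u' x * frechet_derivative ?\<psi> (at x) (axis i 1) \<partial>lborel) =
          - (\<integral>x. G x $ i * ?\<psi> x \<partial>lborel)"
      by (simp add: G_def)
  qed
  moreover obtain \<alpha> where \<alpha>: "0 < \<alpha>" "modular \<Phi> UNIV (\<lambda>x. u x / \<alpha>) < \<infinity>"
    using u by (auto simp: orlicz_sobolev_space_def orlicz_space_def)
  moreover have "(\<integral>\<^sup>+x. ennreal (\<Phi> (u' x / \<alpha>)) \<partial>lborel) = modular \<Phi> UNIV (\<lambda>x. u x / \<alpha>)"
    unfolding modular_eq_nn_integral[OF N]
    by (rule nn_integral_cong_AE) (use u'(2) in eventually_elim, simp)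
  ultimately show thesis
    using u' by (intro that[of u' \<alpha>]) auto
qed

lemma orlicz_space_of_representative:
  fixes f g :: "real^'n \<Rightarrow> real"
  assumes N: "N_function \<Phi>" and g: "locally_integrable g" and fg: "AE x in lborel. f x = g x"
    and K: "K \<subseteq> cball 0 R" and \<alpha>: "0 < \<alpha>"
    and fin: "(\<integral>\<^sup>+x. ennreal (\<Phi> (g x / \<alpha>)) * indicator (cball 0 R) x \<partial>lborel) < \<infinity>"
  shows "f \<in> orlicz_space \<Phi> K"
proof -
  have "g \<in> borel_measurable lebesgue"
    using locally_integrable_borel[OF g] by (intro measurable_completion) simp
  then have fm: "f \<in> borel_measurable lebesgue"
    by (rule borel_measurable_AE) (use fg in \<open>auto simp: AE_completion_iff elim: eventually_mono\<close>)
  have "set_integrable lebesgue C f" if C: "compact C" for C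
  proof -
    have "set_integrable lborel C g"
      using C by (intro locally_integrable_bounded[OF g]) (auto intro: compact_imp_bounded borel_compact)
    then have "integrable lborel (\<lambda>x. indicator C x *\<^sub>R g x)" by (simp add: set_integrable_def)
    then have gi: "integrable lebesgue (\<lambda>x. indicator C x *\<^sub>R g x)"
      by (subst integrable_completion) auto
    have "C \<in> sets lebesgue" by (intro sets_completionI_sets) (simp add: borel_compact C)
    then have "integrable lebesgue (\<lambda>x. indicator C x *\<^sub>R f x)"
      using fm fg
      by (intro Bochner_Integration.integrable_cong_AE_imp[OF gi])
         (auto simp: AE_completion_iff elim: eventually_mono)
    then show ?thesis by (simp add: set_integrable_def)
  qed
  moreover have "modular \<Phi> K (\<lambda>x. f x / \<alpha>) \<le> (\<integral>\<^sup>+x. ennreal (\<Phi> (g x / \<alpha>)) * indicator (cball 0 R) x \<partial>lborel)"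
    unfolding modular_eq_nn_integral[OF N]
    by (rule nn_integral_mono_AE, use fg in eventually_elim) (use K in \<open>auto simp: indicator_def\<close>)
  then have "modular \<Phi> K (\<lambda>x. f x / \<alpha>) < \<infinity>" using fin by (rule le_less_trans)
  ultimately show ?thesis
    using \<alpha> by (auto simp: orlicz_space_def L1_loc_def)
qed

text \<open>On a bounded set the constant \<open>T\<close> in \<open>\<bar>t\<bar> \<le> T + \<Phi> t\<close> is integrable.\<close>

lemma locally_integrable_of_modular:
  fixes v :: "real^'n \<Rightarrow> real"
  assumes N: "N_function \<Phi>" and [measurable]: "v \<in> borel_measurable borel"
    and fin: "\<And>R. \<exists>\<alpha>>0. (\<integral>\<^sup>+x. ennreal (\<Phi> (v x / \<alpha>)) * indicator (cball 0 R) x \<partial>lborel) < \<infinity>"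
  shows "locally_integrable v"
proof -
  have "set_integrable lborel (cball 0 R) v" for R
  proof -
    let ?I = "indicator (cball (0::real^'n) R) :: _ \<Rightarrow> ennreal"
    obtain \<alpha> where \<alpha>: "0 < \<alpha>" "(\<integral>\<^sup>+x. ennreal (\<Phi> (v x / \<alpha>)) * ?I x \<partial>lborel) < \<infinity>"
      using fin by blast
    obtain T where T: "0 < T" "\<And>t. \<bar>t\<bar> \<le> T + \<Phi> t" by (rule N_function_ge_linear[OF N]) blast
    have Vm: "(\<lambda>x. ennreal (\<Phi> (v x / \<alpha>)) * ?I x) \<in> borel_measurable lborel"
      by (auto intro!: borel_measurable_times_ennreal borel_measurable_indicator N_function_borel_ennreal[OF N])
    have Im: "(\<lambda>x. ennreal (\<alpha> * T) * ?I x) \<in> borel_measurable lborel"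
      by (auto intro!: borel_measurable_times_ennreal borel_measurable_indicator)
    have "ennreal (norm (indicator (cball 0 R) x *\<^sub>R v x)) \<le>
        ennreal (\<alpha> * T) * ?I x + ennreal \<alpha> * (ennreal (\<Phi> (v x / \<alpha>)) * ?I x)" for x
    proof (cases "x \<in> cball 0 R")
      case True
      have "\<bar>v x\<bar> = \<alpha> * \<bar>v x / \<alpha>\<bar>" using \<alpha>(1) by simp
      also have "\<dots> \<le> \<alpha> * (T + \<Phi> (v x / \<alpha>))" using \<alpha>(1) by (intro mult_left_mono T(2)) simp
      finally have "ennreal \<bar>v x\<bar> \<le> ennreal (\<alpha> * T + \<alpha> * \<Phi> (v x / \<alpha>))"
        by (intro ennreal_leI) (simp add: algebra_simps)
      also have "\<dots> = ennreal (\<alpha> * T) + ennreal \<alpha> * ennreal (\<Phi> (v x / \<alpha>))"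
        using \<alpha>(1) T(1) N_function_nonneg[OF N, of "v x / \<alpha>"]
        by (subst ennreal_plus) (auto simp: ennreal_mult)
      finally show ?thesis using True by simp
    qed simp
    then have "(\<integral>\<^sup>+x. ennreal (norm (indicator (cball 0 R) x *\<^sub>R v x)) \<partial>lborel) \<le>
        (\<integral>\<^sup>+x. ennreal (\<alpha> * T) * ?I x + ennreal \<alpha> * (ennreal (\<Phi> (v x / \<alpha>)) * ?I x) \<partial>lborel)"
      by (intro nn_integral_mono)
    also have "\<dots> = ennreal (\<alpha> * T) * emeasure lborel (cball (0::real^'n) R) +
        ennreal \<alpha> * (\<integral>\<^sup>+x. ennreal (\<Phi> (v x / \<alpha>)) * ?I x \<partial>lborel)"
      using Vm Im by (subst nn_integral_add) (auto simp: nn_integral_cmult nn_integral_cmult_indicator)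
    also have "\<dots> < \<infinity>"
      using \<alpha>(2) emeasure_bounded_finite[of "cball (0::real^'n) R"]
      by (auto simp: ennreal_mult_less_top)
    finally show ?thesis
      unfolding set_integrable_def
      by (intro integrableI_bounded borel_measurable_scaleR borel_measurable_indicator) auto
  qed
  then show ?thesis by (simp add: locally_integrable_def)
qed

lemma modular_difference_finite:
  assumes N: "N_function \<Phi>" and [measurable]: "f \<in> borel_measurable borel" "g \<in> borel_measurable borel"
    and c: "0 < \<alpha>" "0 < \<beta>" and A: "A \<in> sets borel"
    and f: "(\<integral>\<^sup>+x. ennreal (\<Phi> (f x / \<alpha>)) * indicator A x \<partial>lborel) < \<infinity>"
    and fg: "(\<integral>\<^sup>+x. ennreal (\<Phi> ((f x - g x) / \<beta>)) * indicator A x \<partial>lborel) < \<infinity>"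
  shows "\<exists>\<gamma>>0. (\<integral>\<^sup>+x. ennreal (\<Phi> (g x / \<gamma>)) * indicator A x \<partial>lborel) < \<infinity>"
proof (intro exI conjI)
  define c where "c = max \<alpha> \<beta>"
  have c': "0 < c" "\<alpha> \<le> c" "\<beta> \<le> c" using c by (auto simp: c_def)
  show "0 < 2 * c" using c' by simp
  have "ennreal (\<Phi> (g x / (2 * c))) \<le> ennreal (\<Phi> (f x / \<alpha>)) + ennreal (\<Phi> ((f x - g x) / \<beta>))" for x
  proof -
    have "\<Phi> (g x / (2 * c)) = \<Phi> ((f x / c + - ((f x - g x) / c)) / 2)"
      using c' by (intro arg_cong[where f = \<Phi>]) (simp add: field_simps)
    also have "\<dots> \<le> (\<Phi> (f x / c) + \<Phi> (- ((f x - g x) / c))) / 2" by (rule N_function_mean2[OF N])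
    also have "\<Phi> (f x / c) \<le> \<Phi> (f x / \<alpha>)"
      using c c' by (intro N_function_mono[OF N]) (auto intro: divide_left_mono)
    also have "\<Phi> (- ((f x - g x) / c)) \<le> \<Phi> ((f x - g x) / \<beta>)"
      using c c' by (intro N_function_mono[OF N]) (auto intro: divide_left_mono)
    also have "(\<Phi> (f x / \<alpha>) + \<Phi> ((f x - g x) / \<beta>)) / 2 \<le> \<Phi> (f x / \<alpha>) + \<Phi> ((f x - g x) / \<beta>)"
    proof -
      have "(s + t) / 2 \<le> s + t" if "0 \<le> s" "0 \<le> t" for s t :: real
        using that by (simp add: field_simps)
      then show ?thesis using N_function_nonneg[OF N] by blast
    qed
    finally have "ennreal (\<Phi> (g x / (2 * c))) \<le> ennreal (\<Phi> (f x / \<alpha>) + \<Phi> ((f x - g x) / \<beta>))"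
      by (auto intro: ennreal_leI simp: divide_right_mono add_mono)
    then show ?thesis using N_function_nonneg[OF N] by simp
  qed
  then have "(\<integral>\<^sup>+x. ennreal (\<Phi> (g x / (2 * c))) * indicator A x \<partial>lborel) \<le>
      (\<integral>\<^sup>+x. ennreal (\<Phi> (f x / \<alpha>)) * indicator A x + ennreal (\<Phi> ((f x - g x) / \<beta>)) * indicator A x \<partial>lborel)"
    by (intro nn_integral_mono) (auto simp: indicator_def)
  also have "\<dots> = (\<integral>\<^sup>+x. ennreal (\<Phi> (f x / \<alpha>)) * indicator A x \<partial>lborel) +
      (\<integral>\<^sup>+x. ennreal (\<Phi> ((f x - g x) / \<beta>)) * indicator A x \<partial>lborel)"
    using A by (intro nn_integral_add)
      (auto intro!: borel_measurable_times_ennreal borel_measurable_indicator N_function_borel_ennreal[OF N])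
  also have "\<dots> < \<infinity>" using f fg by simp
  finally show "(\<integral>\<^sup>+x. ennreal (\<Phi> (g x / (2 * c))) * indicator A x \<partial>lborel) < \<infinity>" .
qed

lemma luxemburg_norm_le:
  assumes "0 < c" "modular \<Phi> K (\<lambda>x. f x / c) \<le> 1"
  shows "0 \<le> luxemburg_norm \<Phi> K f" "luxemburg_norm \<Phi> K f \<le> c"
proof -
  let ?S = "{\<alpha>. 0 < \<alpha> \<and> modular \<Phi> K (\<lambda>x. f x / \<alpha>) \<le> 1}"
  have "c \<in> ?S" using assms by simp
  moreover have "bdd_below ?S" by (intro bdd_belowI[of _ 0]) auto
  ultimately show "luxemburg_norm \<Phi> K f \<le> c" unfolding luxemburg_norm_def by (intro cInf_lower)
  show "0 \<le> luxemburg_norm \<Phi> K f"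
    unfolding luxemburg_norm_def using \<open>c \<in> ?S\<close> by (intro cInf_greatest) auto
qed

section \<open>Integer translates with a nonzero limit\<close>

theorem theorem1p4:
  fixes \<Phi> :: "real \<Rightarrow> real"
    and u :: "nat \<Rightarrow> real^'n \<Rightarrow> real"
    and M \<epsilon> \<delta> :: real
  assumes "N_function \<Phi>"
    and "\<Phi> C1_differentiable_on UNIV"
    and "\<And>n. u n \<in> orlicz_sobolev_space \<Phi> UNIV"
    and "\<And>n. modular \<Phi> UNIV (\<lambda>x. norm (weak_grad UNIV (u n) x)) \<le> ennreal M"
    and "\<epsilon> > 0" and "\<delta> > 0"
    and "\<And>n. emeasure lebesgue {x. \<bar>u n x\<bar> > \<epsilon>} \<ge> ennreal \<delta>"
  shows "\<exists>z :: nat \<Rightarrow> real^'n. (\<forall>n i. z n $ i \<in> \<int>) \<and>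
           (\<exists>r v. strict_mono r \<and>
              converges_orlicz_loc \<Phi> ((\<lambda>n x. u n (x + z n)) \<circ> r) v \<and>
              \<not> (AE x in lebesgue. v x = 0))"
proof -
  note N = assms(1)
  define m where "m = max M 0"
  have m: "0 \<le> m" "ennreal m = ennreal M" by (auto simp: m_def max_def ennreal_neg)
  \<comment> \<open>A Borel representative of \<open>u n\<close> and a constant that makes its modular finite.\<close>
  define rep where "rep n u' \<alpha> \<longleftrightarrow>
      locally_integrable u' \<and> (AE x in lborel. u n x = u' x) \<and> u n \<in> borel_measurable lebesgue \<and>
      increments_bounded \<Phi> m u' \<and> 0 < \<alpha> \<and> (\<integral>\<^sup>+x. ennreal (\<Phi> (u' x / \<alpha>)) \<partial>lborel) < \<infinity>"
    for n u' \<alpha>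
  have "\<exists>q. rep n (fst q) (snd q)" for n
  proof -
    have "modular \<Phi> UNIV (\<lambda>x. norm (weak_grad UNIV (u n) x)) \<le> ennreal m"
      using assms(4)[of n] by (simp add: m)
    then obtain u' \<alpha> where "rep n u' \<alpha>"
      by (rule orlicz_sobolev_representative[OF N assms(3)[of n]]) (simp add: rep_def)
    then show ?thesis by (intro exI[of _ "(u', \<alpha>)"]) simp
  qed
  then obtain q where q: "\<And>n. rep n (fst (q n)) (snd (q n))" by metis
  define u' \<alpha> where "u' n = fst (q n)" and "\<alpha> n = snd (q n)" for n
  have u': "\<And>n. locally_integrable (u' n)" "\<And>n. AE x in lborel. u n x = u' n x"
      "\<And>n. u n \<in> borel_measurable lebesgue" "\<And>n. increments_bounded \<Phi> m (u' n)" "\<And>n. 0 < \<alpha> n"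
      "\<And>n. (\<integral>\<^sup>+x. ennreal (\<Phi> (u' n x / \<alpha> n)) \<partial>lborel) < \<infinity>"
    using q by (auto simp: rep_def u'_def \<alpha>_def)
  have [measurable]: "u' n \<in> borel_measurable borel" for n
    by (rule locally_integrable_borel[OF u'(1)])
  obtain L where L: "0 < L" "m / \<delta> < \<Phi> L" by (rule N_function_unbounded[OF N])
  \<comment> \<open>This scale makes \<open>\<Phi>(\<epsilon> / (2 h)) \<delta>\<close> larger than the bound on the modular.\<close>
  define h where "h = \<epsilon> / (2 * L)"
  have h: "0 < h" "\<epsilon> / (2 * h) = L" using L(1) assms(5) by (auto simp: h_def)
  have "\<exists>x. \<bar>ball_average h (u' n) x\<bar> = \<epsilon> / 2" for n
  proof (rule ball_average_attains_level[OF N u'(1) u'(4) h(1) m(1) assms(5) u'(5,6)])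
    have "{x. \<epsilon> < \<bar>u n x\<bar>} \<in> sets lebesgue"
    proof -
      have "(\<lambda>x. \<bar>u n x\<bar>) \<in> borel_measurable lebesgue"
        by (intro borel_measurable_abs u'(3))
      from borel_measurable_less[OF borel_measurable_const[of \<epsilon>] this] show ?thesis by simp
    qed
    moreover have "{x. \<epsilon> < \<bar>u' n x\<bar>} \<in> sets lborel" by measurable
    ultimately have "emeasure lebesgue {x. \<epsilon> < \<bar>u n x\<bar>} = emeasure lebesgue {x. \<epsilon> < \<bar>u' n x\<bar>}"
      by (intro emeasure_eq_AE) (use u'(2)[of n] in \<open>auto simp: AE_completion_iff elim: eventually_mono\<close>)
    then have "ennreal \<delta> \<le> emeasure lborel {x. \<epsilon> < \<bar>u' n x\<bar>}"
      using assms(7)[of n] \<open>{x. \<epsilon> < \<bar>u' n x\<bar>} \<in> sets lborel\<close> by (simp add: emeasure_completion)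
    moreover have "m < \<Phi> L * \<delta>" using L(2) assms(6) by (simp add: field_simps)
    then have "ennreal m < ennreal (\<Phi> L) * ennreal \<delta>"
      using m(1) assms(6) N_function_nonneg[OF N, of L] by (simp add: ennreal_mult[symmetric] ennreal_less_iff)
    ultimately show "ennreal m < ennreal (\<Phi> (\<epsilon> / (2 * h))) * emeasure lborel {x. \<epsilon> < \<bar>u' n x\<bar>}"
      unfolding h(2) by (meson less_le_trans mult_left_mono zero_le)
  qed
  then obtain X where X: "\<And>n. \<bar>ball_average h (u' n) (X n)\<bar> = \<epsilon> / 2" by metis
  \<comment> \<open>Translating by the integer part keeps the points of level \<open>\<epsilon>/2\<close> in the unit cube.\<close>
  define z :: "nat \<Rightarrow> real^'n" where "z n = (\<chi> i. of_int \<lfloor>X n $ i\<rfloor>)" for n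
  define w where "w n x = u' n (x + z n)" for n x
  have w: "locally_integrable (w n)" for n
    unfolding w_def by (rule locally_integrable_shift[OF u'(1)])
  have inc: "increments_bounded \<Phi> m (w n)" for n
    unfolding w_def by (intro increments_bounded_shift[OF N _ u'(4)]) measurable
  have uw: "AE x in lborel. u n (x + z n) = w n x" for n
    unfolding w_def by (rule AE_lborel_shift[OF u'(2)])
  have p: "norm (X n - z n) \<le> real CARD('n)" for n
  proof -
    have "norm (X n - z n) \<le> (\<Sum>i\<in>UNIV. \<bar>(X n - z n) $ i\<bar>)" by (rule norm_le_l1_cart)
    also have "\<dots> \<le> (\<Sum>i\<in>(UNIV :: 'n set). 1)"
      by (intro sum_mono) (simp add: z_def, linarith)
    finally show ?thesis by simp
  qed
  have anchor: "\<bar>ball_average h (w n) (X n - z n)\<bar> = \<epsilon> / 2" for n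
    unfolding w_def ball_average_shift using X[of n] by simp
  obtain r v where r: "strict_mono r" and v[measurable]: "v \<in> borel_measurable borel"
    and conv: "\<And>c R. 0 < c \<Longrightarrow> eventually (\<lambda>n. (\<integral>\<^sup>+x. ennreal (\<Phi> ((w (r n) x - v x) / c)) * indicator (cball 0 R) x \<partial>lborel) \<le> 1) sequentially"
    by (rule modular_compactness[where w = w and p = "\<lambda>n. X n - z n", OF N m(1) w inc h(1) p eq_refl[OF anchor]]) blast
  have nontriv: "\<not> (AE x in lborel. v x = 0)"
    using assms(5) by (intro modular_limit_nontrivial[where w = w and p = "\<lambda>n. X n - z n", OF N w h(1) p _ anchor conv]) auto
  have w_fin: "(\<integral>\<^sup>+x. ennreal (\<Phi> (w n x / \<alpha> n)) * indicator (cball 0 R) x \<partial>lborel) < \<infinity>" for n R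
  proof -
    have "(\<integral>\<^sup>+x. ennreal (\<Phi> (w n x / \<alpha> n)) * indicator (cball 0 R) x \<partial>lborel) \<le>
        (\<integral>\<^sup>+x. ennreal (\<Phi> (u' n (x + z n) / \<alpha> n)) \<partial>lborel)"
      by (intro nn_integral_mono) (auto simp: w_def indicator_def)
    also have "\<dots> = (\<integral>\<^sup>+x. ennreal (\<Phi> (u' n x / \<alpha> n)) \<partial>lborel)"
      by (rule nn_integral_lborel_shift[OF N_function_borel_ennreal[OF N]]) measurable
    also note u'(6)
    finally show ?thesis .
  qed
  have v_fin: "\<exists>\<gamma>>0. (\<integral>\<^sup>+x. ennreal (\<Phi> (v x / \<gamma>)) * indicator (cball 0 R) x \<partial>lborel) < \<infinity>" for R
  proof -
    obtain n where n: "(\<integral>\<^sup>+x. ennreal (\<Phi> ((w (r n) x - v x) / 1)) * indicator (cball 0 R) x \<partial>lborel) \<le> 1"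
      using conv[of 1 R] by (auto simp: eventually_sequentially)
    show ?thesis
      by (rule modular_difference_finite[OF N locally_integrable_borel[OF w] v u'(5) _ _ w_fin le_less_trans[OF n]]) auto
  qed
  have v_loc: "locally_integrable v"
    by (rule locally_integrable_of_modular[OF N v v_fin])
  have "converges_orlicz_loc \<Phi> ((\<lambda>n x. u n (x + z n)) \<circ> r) v"
    unfolding converges_orlicz_loc_def
  proof (intro allI impI conjI)
    fix K :: "(real^'n) set"
    assume "bounded K \<and> K \<in> sets lebesgue"
    then obtain R where K: "K \<subseteq> cball 0 R"
      by (auto simp: bounded_iff subset_eq)
    show "((\<lambda>n x. u n (x + z n)) \<circ> r) n \<in> orlicz_space \<Phi> K" for n
      unfolding o_def by (rule orlicz_space_of_representative[OF N w uw K u'(5) w_fin])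
    obtain \<gamma> where "0 < \<gamma>" "(\<integral>\<^sup>+x. ennreal (\<Phi> (v x / \<gamma>)) * indicator (cball 0 R) x \<partial>lborel) < \<infinity>"
      using v_fin by blast
    then show "v \<in> orlicz_space \<Phi> K"
      by (intro orlicz_space_of_representative[OF N v_loc _ K]) auto
    show "(\<lambda>n. luxemburg_norm \<Phi> K (\<lambda>x. ((\<lambda>n x. u n (x + z n)) \<circ> r) n x - v x)) \<longlonglongrightarrow> 0"
    proof (rule tendstoI)
      fix e :: real assume e: "0 < e"
      then have "0 < e / 2" by simp
      from conv[OF this, of R]
      show "eventually (\<lambda>n. dist (luxemburg_norm \<Phi> K (\<lambda>x. ((\<lambda>n x. u n (x + z n)) \<circ> r) n x - v x)) 0 < e) sequentially"
      proof eventually_elim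
        case (elim n)
        have "modular \<Phi> K (\<lambda>x. (u (r n) (x + z (r n)) - v x) / (e / 2)) \<le>
            (\<integral>\<^sup>+x. ennreal (\<Phi> ((w (r n) x - v x) / (e / 2))) * indicator (cball 0 R) x \<partial>lborel)"
          unfolding modular_eq_nn_integral[OF N]
          by (rule nn_integral_mono_AE, use uw[of "r n"] in eventually_elim) (use K in \<open>auto simp: indicator_def\<close>)
        also note elim
        finally have "modular \<Phi> K (\<lambda>x. (u (r n) (x + z (r n)) - v x) / (e / 2)) \<le> 1" .
        from luxemburg_norm_le[OF \<open>0 < e / 2\<close> this] e show ?case
          by (simp add: dist_real_def)
      qed
    qed
  qed
  moreover have "z n $ i \<in> \<int>" for n i by (simp add: z_def)
  moreover have "\<not> (AE x in lebesgue. v x = 0)" using nontriv by (simp add: AE_completion_iff)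
  ultimately show ?thesis using r by blast
qed

end
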